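(* Let $\mathbb{S}^1=\mathbb{R}/\mathbb{Z}$ and let $SS^1(\mathbb{S}^1)\subseteq C^1(\mathbb{S}^1)$ be the set of those $f\in C^1(\mathbb{S}^1)$ for which the dynamical system $\dot{x}=f(x)$ on $\mathbb{S}^1$ is $C^1$ structurally stable. Then $SS^1(\mathbb{S}^1)$ is open and dense in $C^1(\mathbb{S}^1)$ with respect to the $C^1$-topology.
   Context: $\mathbb{S}^1=\mathbb{R}/\mathbb{Z}$ is the circle, represented as the unit interval $[0,1]$ with end points identified. $C^1(\mathbb{S}^1)$ is the set of $C^1$ functions $f:\mathbb{S}^1\to\mathbb{R}$, equivalently continuously differentiable functions $f:\mathbb{R}\to\mathbb{R}$ with $f(x+1)=f(x)$ for all $x$. Each such $f$ is regarded as a vector field on $\mathbb{S}^1$, defining the dynamical system $\dot{x}=f(x)$ on $\mathbb{S}^1$, and a system is identified with its vector field $f$. $C^1$-norm: $\|f\|_1:=\sup_{x\in\mathbb{S}^1}|f(x)|+\sup_{x\in\mathbb{S}^1}|f'(x)|$. For $\epsilon>0$, $B^1_\epsilon(f):=\{g\in C^1(\mathbb{S}^1):\|g-f\|_1<\epsilon\}$. The $C^1$-topology on $C^1(\mathbb{S}^1)$ is the topology generated by this norm. The orbit of a point $x_0\in\mathbb{S}^1$ is $\{x(t):t\in\mathbb{R}\}$, where $x(\cdot)$ is the solution with $x(0)=x_0$, oriented by increasing time. Two systems $\dot{x}=f(x)$ and $\dot{y}=g(y)$ on $\mathbb{S}^1$ are topologically equivalent if there is a homeomorphism $h:\mathbb{S}^1\to\mathbb{S}^1$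 that maps oriented orbits of the first system onto oriented orbits of the second, i.e. it maps each orbit of the first onto an orbit of the second, preserving the orientation by increasing time. The system $\dot{x}=f(x)$ is $C^1$ structurally stable if for every sufficiently small $\epsilon>0$ and every $g\in B^1_\epsilon(f)$, the systems $\dot{x}=f(x)$ and $\dot{y}=g(y)$ are topologically equivalent (equivalently, there exists $\epsilon>0$ such that this holds for every $g\in B^1_\epsilon(f)$). *)

theory Defs
  imports "HOL-Analysis.Analysis"
begin

quotient_type circle = real / "\<lambda>x y :: real. x - y \<in> \<int>"
  morphisms rep_circle circle_of
proof (rule equivpI)
  show "reflp (\<lambda>x y :: real. x - y \<in> \<int>)"
    by (simp add: reflp_def)
  show "symp (\<lambda>x y :: real. x - y \<in> \<int>)"
    by (rule sympI) (metis Ints_minus minus_diff_eq)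
  show "transp (\<lambda>x y :: real. x - y \<in> \<int>)"
  proof (rule transpI)
    fix x y z :: real
    assume "x - y \<in> \<int>" "y - z \<in> \<int>"
    then have "(x - y) + (y - z) \<in> \<int>" by (rule Ints_add)
    then show "x - z \<in> \<int>" by simp
  qed
qed

lemma circle_of_eq_iff: "circle_of x = circle_of y \<longleftrightarrow> x - y \<in> \<int>"
  by (rule circle.abs_eq_iff)

lemma surj_circle_of: "surj circle_of"
proof (rule surjI)
  show "circle_of (rep_circle p) = p" for p
    by (rule Quotient3_abs_rep[OF Quotient3_circle])
qed

text \<open>The quotient topology of the real line.\<close>

instantiation circle :: topological_space
begin

definition open_circle :: "circle set \<Rightarrow> bool" where
  "open_circle U \<longleftrightarrow> open (circle_of -` U)"

instance
  by standard (auto simp: open_circle_def vimage_Int vimage_Union)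

end

lemma continuous_on_circle_of: "continuous_on S circle_of"
  by (rule continuous_on_subset[of UNIV])
     (auto simp: continuous_on_open_vimage open_circle_def)

text \<open>
  A function on the circle is differentiated through its one-periodic lift
  \<^term>\<open>f \<circ> circle_of\<close> to the real line.
\<close>

definition C1_circle :: "(circle \<Rightarrow> real) set" where
  "C1_circle = {f. (f \<circ> circle_of) C1_differentiable_on UNIV}"

definition C1_norm :: "(circle \<Rightarrow> real) \<Rightarrow> real" where
  "C1_norm f = (SUP p. \<bar>f p\<bar>) + (SUP x. \<bar>deriv (f \<circ> circle_of) x\<bar>)"

text \<open>
  \<^locale>\<open>Metric_space\<close> wants nonnegativity and symmetry on the whole type, whereas the
  suprema are only meaningful for \<^term>\<open>f \<in> C1_circle\<close>; hence the guard.
\<close>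

definition C1_dist :: "(circle \<Rightarrow> real) \<Rightarrow> (circle \<Rightarrow> real) \<Rightarrow> real" where
  "C1_dist f g =
    (if f \<in> C1_circle \<and> g \<in> C1_circle then C1_norm (\<lambda>p. g p - f p) else 0)"

definition C1_ball :: "(circle \<Rightarrow> real) \<Rightarrow> real \<Rightarrow> (circle \<Rightarrow> real) set" where
  "C1_ball f \<epsilon> = {g \<in> C1_circle. C1_norm (\<lambda>p. g p - f p) < \<epsilon>}"

definition C1_topology :: "(circle \<Rightarrow> real) topology" where
  "C1_topology = Metric_space.mtopology C1_circle C1_dist"

lemma C1_circle_has_deriv:
  assumes "f \<in> C1_circle"
  shows "((f \<circ> circle_of) has_real_derivative deriv (f \<circ> circle_of) x) (at x)"
    and "continuous_on UNIV (deriv (f \<circ> circle_of))"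
proof -
  obtain D where D: "\<And>x. ((f \<circ> circle_of) has_vector_derivative D x) (at x)"
    and cont: "continuous_on UNIV D"
    using assms by (auto simp: C1_circle_def C1_differentiable_on_def)
  have D': "((f \<circ> circle_of) has_real_derivative D x) (at x)" for x
    using D by (simp add: has_real_derivative_iff_has_vector_derivative)
  then have "deriv (f \<circ> circle_of) = D"
    by (auto intro!: DERIV_imp_deriv)
  with D' cont show "((f \<circ> circle_of) has_real_derivative deriv (f \<circ> circle_of) x) (at x)"
    and "continuous_on UNIV (deriv (f \<circ> circle_of))" by simp_all
qed

lemma deriv_periodic:
  assumes "f \<in> C1_circle" "circle_of x = circle_of y"
  shows "deriv (f \<circ> circle_of) x = deriv (f \<circ> circle_of) y"
proof -
  let ?F = "f \<circ> circle_of"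
  have per: "?F (t + (y - x)) = ?F t" for t
  proof -
    have "y - x \<in> \<int>" using assms(2) circle_of_eq_iff by metis
    then have "circle_of (t + (y - x)) = circle_of t"
      by (simp add: circle_of_eq_iff)
    then show ?thesis by simp
  qed
  have "(?F has_real_derivative deriv ?F y) (at (x + (y - x)))"
    using C1_circle_has_deriv(1)[OF assms(1), of y] by simp
  then have "((\<lambda>t. ?F (t + (y - x))) has_real_derivative deriv ?F y) (at x)"
    by (simp only: DERIV_shift)
  then have "(?F has_real_derivative deriv ?F y) (at x)"
    by (simp only: per)
  then show ?thesis by (rule DERIV_imp_deriv)
qed

lemma bounded_range_if_periodic:
  fixes F :: "real \<Rightarrow> real"
  assumes "continuous_on UNIV F" "\<And>x y. circle_of x = circle_of y \<Longrightarrow> F x = F y"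
  shows "bdd_above (range (\<lambda>x. \<bar>F x\<bar>))"
proof -
  have "range F \<subseteq> F ` {0..1}"
  proof
    fix z assume "z \<in> range F"
    then obtain x where "z = F x" by auto
    moreover have "F x = F (frac x)"
      by (rule assms(2)) (simp add: circle_of_eq_iff frac_def)
    moreover have "frac x \<in> {0..1}"
      using frac_lt_1[of x] by (simp add: less_imp_le)
    ultimately show "z \<in> F ` {0..1}" by blast
  qed
  moreover have "compact (F ` {0..1})"
    by (rule compact_continuous_image) (use assms(1) continuous_on_subset in auto)
  ultimately have "bounded (range F)"
    using compact_imp_bounded bounded_subset by blast
  then obtain B where "\<And>x. \<bar>F x\<bar> \<le> B"
    by (auto simp: bounded_iff)
  then show ?thesis by (intro bdd_aboveI2)
qed

lemma C1_circle_bdd: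
  assumes "f \<in> C1_circle"
  shows "bdd_above (range (\<lambda>p. \<bar>f p\<bar>))"
    and "bdd_above (range (\<lambda>x. \<bar>deriv (f \<circ> circle_of) x\<bar>))"
proof -
  have "continuous_on UNIV (f \<circ> circle_of)"
    using assms C1_differentiable_imp_continuous_on by (auto simp: C1_circle_def o_def)
  then have "bdd_above (range (\<lambda>x. \<bar>(f \<circ> circle_of) x\<bar>))"
    by (rule bounded_range_if_periodic) simp
  moreover have "range (\<lambda>x. \<bar>(f \<circ> circle_of) x\<bar>) = range (\<lambda>p. \<bar>f p\<bar>)"
  proof -
    have "range (\<lambda>x. \<bar>(f \<circ> circle_of) x\<bar>) = (\<lambda>p. \<bar>f p\<bar>) ` range circle_of"
      by (auto simp: image_image)
    then show ?thesis by (simp only: surj_circle_of)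
  qed
  ultimately show "bdd_above (range (\<lambda>p. \<bar>f p\<bar>))" by simp
  show "bdd_above (range (\<lambda>x. \<bar>deriv (f \<circ> circle_of) x\<bar>))"
    using C1_circle_has_deriv(2)[OF assms] deriv_periodic[OF assms]
    by (rule bounded_range_if_periodic)
qed

lemma C1_circle_diff:
  assumes "f \<in> C1_circle" "g \<in> C1_circle"
  shows "(\<lambda>p. f p - g p) \<in> C1_circle"
proof -
  have "(\<lambda>x. (f \<circ> circle_of) x - (g \<circ> circle_of) x) C1_differentiable_on UNIV"
    using assms by (intro C1_differentiable_on_diff) (auto simp: C1_circle_def o_def)
  then show ?thesis by (simp add: C1_circle_def o_def)
qed

lemma deriv_diff_circle:
  assumes "f \<in> C1_circle" "g \<in> C1_circle"
  shows "deriv ((\<lambda>p. f p - g p) \<circ> circle_of) x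
    = deriv (f \<circ> circle_of) x - deriv (g \<circ> circle_of) x"
proof -
  have "((\<lambda>x. (f \<circ> circle_of) x - (g \<circ> circle_of) x) has_real_derivative
      deriv (f \<circ> circle_of) x - deriv (g \<circ> circle_of) x) (at x)"
    by (intro DERIV_diff C1_circle_has_deriv assms)
  then show ?thesis by (intro DERIV_imp_deriv) (simp add: o_def)
qed

lemma C1_norm_bounds:
  assumes "f \<in> C1_circle"
  shows "\<bar>f p\<bar> \<le> (SUP p. \<bar>f p\<bar>)" "0 \<le> (SUP p. \<bar>f p\<bar>)"
    "\<bar>deriv (f \<circ> circle_of) x\<bar> \<le> (SUP x. \<bar>deriv (f \<circ> circle_of) x\<bar>)"
    "0 \<le> (SUP x. \<bar>deriv (f \<circ> circle_of) x\<bar>)"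
proof -
  show a: "\<bar>f p\<bar> \<le> (SUP p. \<bar>f p\<bar>)" for p
    using C1_circle_bdd(1)[OF assms] by (intro cSUP_upper) auto
  show "0 \<le> (SUP p. \<bar>f p\<bar>)" by (rule order_trans[OF abs_ge_zero a])
  show b: "\<bar>deriv (f \<circ> circle_of) x\<bar> \<le> (SUP x. \<bar>deriv (f \<circ> circle_of) x\<bar>)" for x
    using C1_circle_bdd(2)[OF assms] by (intro cSUP_upper) auto
  show "0 \<le> (SUP x. \<bar>deriv (f \<circ> circle_of) x\<bar>)" by (rule order_trans[OF abs_ge_zero b])
qed

lemma C1_norm_minus_commute:
  assumes "f \<in> C1_circle" "g \<in> C1_circle"
  shows "C1_norm (\<lambda>p. f p - g p) = C1_norm (\<lambda>p. g p - f p)"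
  unfolding C1_norm_def deriv_diff_circle[OF assms] deriv_diff_circle[OF assms(2,1)]
  by (simp add: abs_minus_commute)

lemma C1_norm_eq_0_iff:
  assumes "f \<in> C1_circle"
  shows "C1_norm f = 0 \<longleftrightarrow> f = (\<lambda>_. 0)"
proof
  assume "C1_norm f = 0"
  then have "(SUP p. \<bar>f p\<bar>) = 0"
    using C1_norm_bounds(2,4)[OF assms] by (simp add: C1_norm_def)
  then have "\<bar>f p\<bar> \<le> 0" for p
    using C1_norm_bounds(1)[OF assms, of p] by simp
  then show "f = (\<lambda>_. 0)" by auto
qed (simp add: C1_norm_def o_def)

lemma C1_norm_triangle:
  assumes "f \<in> C1_circle" "g \<in> C1_circle" "h \<in> C1_circle"
  shows "C1_norm (\<lambda>p. f p - h p) \<le> C1_norm (\<lambda>p. f p - g p) + C1_norm (\<lambda>p. g p - h p)"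
proof -
  let ?fg = "\<lambda>p. f p - g p" and ?gh = "\<lambda>p. g p - h p"
  have fg: "?fg \<in> C1_circle" and gh: "?gh \<in> C1_circle"
    using assms by (auto intro: C1_circle_diff)
  have "(SUP p. \<bar>f p - h p\<bar>) \<le> (SUP p. \<bar>?fg p\<bar>) + (SUP p. \<bar>?gh p\<bar>)"
  proof (rule cSUP_least)
    fix p
    have "\<bar>f p - h p\<bar> \<le> \<bar>?fg p\<bar> + \<bar>?gh p\<bar>" by simp
    also have "\<dots> \<le> (SUP p. \<bar>?fg p\<bar>) + (SUP p. \<bar>?gh p\<bar>)"
      by (intro add_mono C1_norm_bounds(1) fg gh)
    finally show "\<bar>f p - h p\<bar> \<le> (SUP p. \<bar>?fg p\<bar>) + (SUP p. \<bar>?gh p\<bar>)" .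
  qed simp
  moreover have "(SUP x. \<bar>deriv ((\<lambda>p. f p - h p) \<circ> circle_of) x\<bar>)
    \<le> (SUP x. \<bar>deriv (?fg \<circ> circle_of) x\<bar>) + (SUP x. \<bar>deriv (?gh \<circ> circle_of) x\<bar>)"
  proof (rule cSUP_least)
    fix x
    have "\<bar>deriv ((\<lambda>p. f p - h p) \<circ> circle_of) x\<bar>
      \<le> \<bar>deriv (?fg \<circ> circle_of) x\<bar> + \<bar>deriv (?gh \<circ> circle_of) x\<bar>"
      unfolding deriv_diff_circle[OF assms(1,2)] deriv_diff_circle[OF assms(2,3)]
        deriv_diff_circle[OF assms(1,3)] by simp
    also have "\<dots> \<le> (SUP x. \<bar>deriv (?fg \<circ> circle_of) x\<bar>) + (SUP x. \<bar>deriv (?gh \<circ> circle_of) x\<bar>)"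
      by (intro add_mono C1_norm_bounds(3) fg gh)
    finally show "\<bar>deriv ((\<lambda>p. f p - h p) \<circ> circle_of) x\<bar>
      \<le> (SUP x. \<bar>deriv (?fg \<circ> circle_of) x\<bar>) + (SUP x. \<bar>deriv (?gh \<circ> circle_of) x\<bar>)" .
  qed simp
  ultimately show ?thesis by (simp add: C1_norm_def)
qed

lemma Metric_space_C1: "Metric_space C1_circle C1_dist"
proof
  fix f g :: "circle \<Rightarrow> real"
  show "0 \<le> C1_dist f g"
    using C1_norm_bounds(2,4)[OF C1_circle_diff] by (simp add: C1_dist_def C1_norm_def)
  show "C1_dist f g = C1_dist g f"
    by (auto simp: C1_dist_def intro: C1_norm_minus_commute)
next
  fix f g :: "circle \<Rightarrow> real"
  assume "f \<in> C1_circle" "g \<in> C1_circle"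
  then show "C1_dist f g = 0 \<longleftrightarrow> f = g"
    by (auto simp: C1_dist_def C1_norm_eq_0_iff C1_circle_diff fun_eq_iff)
next
  fix f g h :: "circle \<Rightarrow> real"
  assume "f \<in> C1_circle" "g \<in> C1_circle" "h \<in> C1_circle"
  then show "C1_dist f h \<le> C1_dist f g + C1_dist g h"
    using C1_norm_triangle[of h g f] by (simp add: C1_dist_def)
qed

lemma mball_C1: "f \<in> C1_circle \<Longrightarrow> Metric_space.mball C1_circle C1_dist f \<epsilon> = C1_ball f \<epsilon>"
  by (auto simp: Metric_space.mball_def[OF Metric_space_C1] C1_ball_def C1_dist_def)

lemma topspace_C1_topology: "topspace C1_topology = C1_circle"
  unfolding C1_topology_def by (rule Metric_space.topspace_mtopology[OF Metric_space_C1])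

lemma openin_C1_topology:
  "openin C1_topology U \<longleftrightarrow> U \<subseteq> C1_circle \<and> (\<forall>f\<in>U. \<exists>\<epsilon>>0. C1_ball f \<epsilon> \<subseteq> U)"
  unfolding C1_topology_def Metric_space.openin_mtopology[OF Metric_space_C1]
  by (metis mball_C1 subsetD)

text \<open>
  A curve in the circle solves the equation if it has a lift to the real line which does.
\<close>

definition trajectory :: "(circle \<Rightarrow> real) \<Rightarrow> (real \<Rightarrow> circle) \<Rightarrow> bool" where
  "trajectory f \<gamma> \<longleftrightarrow>
    (\<exists>x. \<gamma> = circle_of \<circ> x \<and> (\<forall>t. (x has_real_derivative f (\<gamma> t)) (at t)))"

definition orbit :: "(circle \<Rightarrow> real) \<Rightarrow> circle \<Rightarrow> circle set" where
  "orbit f p = {\<gamma> t |\<gamma> t. trajectory f \<gamma> \<and> \<gamma> 0 = p}"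

text \<open>
  Two parametrized curves trace out the same oriented orbit if they differ by an increasing
  change of time; a strictly increasing surjection of the real line is a homeomorphism.
  This also covers equilibria (constant curves) and periodic orbits.
\<close>

definition same_oriented_curve :: "(real \<Rightarrow> circle) \<Rightarrow> (real \<Rightarrow> circle) \<Rightarrow> bool" where
  "same_oriented_curve \<gamma> \<eta> \<longleftrightarrow> (\<exists>\<tau>. strict_mono \<tau> \<and> surj \<tau> \<and> \<gamma> = \<eta> \<circ> \<tau>)"

definition topologically_equivalent :: "(circle \<Rightarrow> real) \<Rightarrow> (circle \<Rightarrow> real) \<Rightarrow> bool" where
  "topologically_equivalent f g \<longleftrightarrow>
    (\<exists>h h'. homeomorphism UNIV UNIV h h' \<and>
      (\<forall>p. \<exists>q. h ` orbit f p = orbit g q) \<and>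
      (\<forall>\<gamma>. trajectory f \<gamma> \<longrightarrow> (\<exists>\<eta>. trajectory g \<eta> \<and> same_oriented_curve (h \<circ> \<gamma>) \<eta>)))"

definition structurally_stable :: "(circle \<Rightarrow> real) \<Rightarrow> bool" where
  "structurally_stable f \<longleftrightarrow>
    (\<forall>\<^sub>F \<epsilon> in at_right 0. \<forall>g \<in> C1_ball f \<epsilon>. topologically_equivalent f g)"

definition SS1 :: "(circle \<Rightarrow> real) set" where
  "SS1 = {f \<in> C1_circle. structurally_stable f}"

end

theory Submission
  imports Defs
begin

text \<open>
  Openness is formal once topological equivalence is known to be symmetric and transitive, which
  needs existence and uniqueness of solutions. For density, the critical values of \<open>f\<close> are
  negligible by Sard's theorem, so subtracting a small constant makes all zeros of \<open>f\<close> simple, and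
  it remains to see that simple zeros imply stability.

  A solution starting at \<open>a\<close> runs through the whole interval between the zeros adjacent to \<open>a\<close>, in
  the direction given by the sign of the field. Hence a homeomorphism with lift \<open>H\<close> such that
  \<open>g \<circ> H\<close> and \<open>f\<close> have the same sign everywhere is a topological equivalence. If all zeros of \<open>f\<close> are
  simple, there is \<open>m > 0\<close> with \<open>\<bar>f'\<bar> \<ge> m\<close> wherever \<open>\<bar>f\<bar> \<le> m\<close>. Blend a nearby \<open>g\<close> into \<open>f\<close> by a cutoff
  that is 1 near the zeros of \<open>f\<close> and 0 where \<open>\<bar>f\<bar> \<ge> m\<close>. The blend has the sign of \<open>g\<close> and, on
  every component of \<open>{\<bar>f\<bar> < m}\<close>, is strictly monotone with the same boundary values as \<open>f\<close>, so
  that inverting it there against \<open>f\<close> gives \<open>H\<close>.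
\<close>

section \<open>Scalar autonomous equations on the line\<close>

definition solution :: "(real \<Rightarrow> real) \<Rightarrow> (real \<Rightarrow> real) \<Rightarrow> bool" where
  "solution F x \<longleftrightarrow> (\<forall>t. (x has_real_derivative F (x t)) (at t))"

lemma solution_shift:
  assumes "solution F x"
  shows "solution F (\<lambda>t. x (t + s))"
  unfolding solution_def
proof
  fix t
  have "(x has_real_derivative F (x (t + s))) (at (t + s))"
    using assms by (simp add: solution_def)
  then show "((\<lambda>t. x (t + s)) has_real_derivative F (x (t + s))) (at t)"
    by (simp only: DERIV_shift)
qed

lemma solution_reverse:
  assumes "solution F x"
  shows "solution (\<lambda>u. - F u) (\<lambda>t. x (- t))"
  unfolding solution_def
proof
  fix t
  have "(x has_real_derivative F (x (- t))) (at (- t))"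
    using assms by (simp add: solution_def)
  then show "((\<lambda>t. x (- t)) has_real_derivative - F (x (- t))) (at t)"
    by (simp only: DERIV_mirror)
qed

lemma solution_const: "F a = 0 \<Longrightarrow> solution F (\<lambda>_. a)"
  by (simp add: solution_def)

text \<open>Gronwall's argument: by the Lipschitz bound the squared distance weighted by
  \<open>exp (- 2 * L * r)\<close> cannot increase, and it vanishes at \<open>s\<close>.\<close>

lemma solution_unique_forward:
  assumes lip: "\<And>u v. \<bar>F u - F v\<bar> \<le> L * \<bar>u - v\<bar>"
    and x: "solution F x" and y: "solution F y" and eq: "x s = y s" and "s \<le> t"
  shows "x t = y t"
proof -
  define w where "w = (\<lambda>r. (x r - y r)\<^sup>2 * exp (- 2 * L * r))"
  have "\<exists>D. (w has_real_derivative D) (at r) \<and> D \<le> 0" for r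
  proof (intro exI conjI)
    let ?D = "2 * ((x r - y r) * (F (x r) - F (y r)) - L * (x r - y r)\<^sup>2) * exp (- 2 * L * r)"
    show "(w has_real_derivative ?D) (at r)"
      unfolding w_def using x y
      by (auto simp: solution_def algebra_simps power2_eq_square
          intro!: derivative_eq_intros DERIV_chain2[of x] DERIV_chain2[of y])
    have "(x r - y r) * (F (x r) - F (y r)) \<le> \<bar>x r - y r\<bar> * \<bar>F (x r) - F (y r)\<bar>"
      by (metis abs_ge_self abs_mult)
    also have "\<dots> \<le> \<bar>x r - y r\<bar> * (L * \<bar>x r - y r\<bar>)"
      by (intro mult_left_mono lip) simp
    also have "\<dots> = L * (x r - y r)\<^sup>2"
      by (simp add: power2_eq_square)
    finally show "?D \<le> 0"
      by (simp add: mult_le_0_iff)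
  qed
  then have "w t \<le> w s"
    by (intro DERIV_nonpos_imp_nonincreasing[OF \<open>s \<le> t\<close>]) auto
  then have "(x t - y t)\<^sup>2 \<le> 0"
    by (simp add: w_def eq mult_le_0_iff)
  then show ?thesis by simp
qed

lemma solution_unique:
  assumes lip: "\<And>u v. \<bar>F u - F v\<bar> \<le> L * \<bar>u - v\<bar>"
    and x: "solution F x" and y: "solution F y" and eq: "x s = y s"
  shows "x = y"
proof
  fix t
  show "x t = y t"
  proof (cases "s \<le> t")
    case True
    then show ?thesis using solution_unique_forward assms by blast
  next
    case False
    have "\<bar>- F u - - F v\<bar> \<le> L * \<bar>u - v\<bar>" for u v
      using lip[of v u] by (simp add: abs_minus_commute)
    from solution_unique_forward[OF this solution_reverse[OF x] solution_reverse[OF y], of "-s" "-t"]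
    show ?thesis using False eq by simp
  qed
qed

text \<open>Meant to be the orbit of \<open>a\<close> on the line: the component of \<open>a\<close>
  in the set of nonzeros of \<open>F\<close>, but \<open>{a}\<close> if \<open>a\<close> is an
  equilibrium, whence the separate clause \<open>b = a\<close>.\<close>

definition phase_interval :: "(real \<Rightarrow> real) \<Rightarrow> real \<Rightarrow> real set" where
  "phase_interval F a = {b. b = a \<or> (\<forall>z\<in>closed_segment a b. F z \<noteq> 0)}"

text \<open>A connected subset of the line that contains \<open>a\<close> and \<open>b\<close>
  contains the segment between them. Openness and the interval property are then inherited from
  components.\<close>

lemma phase_interval_eq_component:
  assumes "F a \<noteq> 0"
  shows "phase_interval F a = connected_component_set {z. F z \<noteq> 0} a"
proof (rule set_eqI)
  fix b
  have "b \<in> phase_interval F a \<longleftrightarrow> closed_segment a b \<subseteq> {z. F z \<noteq> 0}"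
    using assms by (auto simp: phase_interval_def)
  also have "\<dots> \<longleftrightarrow> connected_component {z. F z \<noteq> 0} a b"
  proof
    assume "closed_segment a b \<subseteq> {z. F z \<noteq> 0}"
    then show "connected_component {z. F z \<noteq> 0} a b"
      unfolding connected_component_def by (intro exI[of _ "closed_segment a b"]) auto
  next
    assume "connected_component {z. F z \<noteq> 0} a b"
    then obtain T where "connected T" "T \<subseteq> {z. F z \<noteq> 0}" "a \<in> T" "b \<in> T"
      unfolding connected_component_def by blast
    then show "closed_segment a b \<subseteq> {z. F z \<noteq> 0}"
      by (metis closed_segment_subset is_interval_connected_1 is_interval_convex_1 subset_trans)
  qed
  finally show "b \<in> phase_interval F a \<longleftrightarrow> b \<in> connected_component_set {z. F z \<noteq> 0} a"
    by simp
qed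

lemma phase_interval_open:
  assumes "continuous_on UNIV F" "F a \<noteq> 0"
  shows "open (phase_interval F a)"
  unfolding phase_interval_eq_component[of F a, OF assms(2)]
  by (intro open_connected_component open_Collect_neq continuous_intros assms(1))

lemma phase_interval_interval:
  assumes "F a \<noteq> 0"
  shows "is_interval (phase_interval F a)"
  unfolding phase_interval_eq_component[of F a, OF assms] is_interval_connected_1 by simp

lemma phase_interval_pos:
  assumes "continuous_on UNIV F" "F a > 0" "b \<in> phase_interval F a"
  shows "F b > 0"
proof (rule ccontr)
  assume "\<not> F b > 0"
  then have "0 \<in> closed_segment (F a) (F b)"
    using assms(2) by (auto simp: closed_segment_eq_real_ivl)
  moreover have "continuous_on (closed_segment a b) F"
    using assms(1) continuous_on_subset by blast
  ultimately obtain z where "z \<in> closed_segment a b" "F z = 0"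
    using IVT'_closed_segment_real[of 0 F a b] by metis
  then show False using assms by (auto simp: phase_interval_def)
qed

lemma phase_interval_mirror: "b \<in> phase_interval (\<lambda>u. F (- u)) (- a) \<longleftrightarrow> - b \<in> phase_interval F a"
proof -
  have "closed_segment (- a) b = uminus ` closed_segment a (- b)"
    by (auto simp: closed_segment_eq_real_ivl image_iff intro: bexI[of _ "- _"])
  then show ?thesis by (auto simp: phase_interval_def)
qed

lemma phase_interval_uminus: "phase_interval (\<lambda>u. - F u) = phase_interval F"
  by (auto simp: phase_interval_def fun_eq_iff)

section \<open>Global existence of solutions by inverting the time map\<close>

lemma continuous_on_lipschitz_real:
  fixes F :: "real \<Rightarrow> real"
  assumes lip: "\<And>u v. \<bar>F u - F v\<bar> \<le> L * \<bar>u - v\<bar>"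
  shows "continuous_on UNIV F"
proof (rule lipschitz_on_continuous_on)
  have "L \<ge> 0" using lip[of 1 0] by simp
  then show "L-lipschitz_on UNIV F"
    using lip by (auto simp: lipschitz_on_def dist_real_def)
qed

text \<open>
  Towards a zero \<open>z\<close> the Lipschitz bound \<open>F b \<le> L * (z - b)\<close> makes the time map diverge
  logarithmically; without a zero the bound on \<open>F\<close> makes it diverge linearly.
\<close>

lemma time_map_unbounded_above:
  assumes lip: "\<And>u v. \<bar>F u - F v\<bar> \<le> L * \<bar>u - v\<bar>" and bd: "\<And>u. \<bar>F u\<bar> \<le> M"
    and "L > 0" "M > 0" "F a > 0" "K \<ge> 0"
    and T: "\<And>b. b \<in> phase_interval F a \<Longrightarrow> (T has_real_derivative 1 / F b) (at b)"
  shows "\<exists>b\<ge>a. b \<in> phase_interval F a \<and> T b \<ge> T a + K"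
proof (cases "\<exists>z\<ge>a. F z = 0")
  case False
  \<comment> \<open>Since \<open>0 < F \<le> M\<close> to the right of \<open>a\<close>, travelling
    the distance \<open>M * K\<close> takes time at least \<open>K\<close>.\<close>
  define b where "b = a + M * K"
  have "a \<le> b" using \<open>M > 0\<close> \<open>K \<ge> 0\<close> by (simp add: b_def)
  have J: "r \<in> phase_interval F a" if "a \<le> r" for r
    using that False by (auto simp: phase_interval_def closed_segment_eq_real_ivl)
  have cont: "continuous_on UNIV F" by (rule continuous_on_lipschitz_real[OF lip])
  have "T a - a / M \<le> T b - b / M"
  proof (rule DERIV_nonneg_imp_nondecreasing[OF \<open>a \<le> b\<close>])
    fix r assume r: "a \<le> r" "r \<le> b"
    have "F r > 0" by (rule phase_interval_pos[OF cont \<open>F a > 0\<close> J[OF r(1)]])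
    then have "1 / F r \<ge> 1 / M" using bd[of r] by (intro divide_left_mono) auto
    moreover have "((\<lambda>b. T b - b / M) has_real_derivative 1 / F r - 1 / M) (at r)"
      by (intro DERIV_diff T J r DERIV_cdivide DERIV_ident)
    ultimately show "\<exists>y. ((\<lambda>b. T b - b / M) has_real_derivative y) (at r) \<and> y \<ge> 0"
      by force
  qed
  moreover have "b / M = a / M + K" using \<open>M > 0\<close> by (simp add: b_def field_simps)
  ultimately have "T b \<ge> T a + K" by simp
  with J[OF \<open>a \<le> b\<close>] \<open>a \<le> b\<close> show ?thesis by blast
next
  case True
  have cont: "continuous_on UNIV F" by (rule continuous_on_lipschitz_real[OF lip])
  define Z where "Z = {a..} \<inter> {z. F z = 0}"
  have "closed Z"
    unfolding Z_def by (intro closed_Int closed_Collect_eq continuous_intros cont closed_atLeast)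
  moreover have "Z \<noteq> {}" "bdd_below Z" using True by (auto simp: Z_def)
  ultimately have zZ: "Inf Z \<in> Z" by (rule closed_contains_Inf[rotated -1])
  define z where "z = Inf Z"
  then have "z \<in> Z" using zZ by simp
  then have Fz: "F z = 0" and "a < z"
    using \<open>F a > 0\<close> by (auto simp: Z_def less_le)
  have zleast: "F r \<noteq> 0" if "a \<le> r" "r < z" for r
    using that cInf_lower[OF _ \<open>bdd_below Z\<close>, of r] by (auto simp: Z_def z_def)
  have J: "r \<in> phase_interval F a" if "a \<le> r" "r < z" for r
    using that zleast by (auto simp: phase_interval_def closed_segment_eq_real_ivl)
  \<comment> \<open>Chosen so that \<open>ln (z - b)\<close> is \<open>ln (z - a) - L * K\<close>:
    the logarithmic lower bound for the elapsed time then equals \<open>K\<close>.\<close>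
  define b where "b = z - (z - a) * exp (- L * K)"
  have "(z - a) * exp (- L * K) \<le> (z - a) * 1"
    using \<open>a < z\<close> \<open>L > 0\<close> \<open>K \<ge> 0\<close> by (intro mult_left_mono) auto
  then have "a \<le> b" by (simp add: b_def)
  have "b < z" using \<open>a < z\<close> by (simp add: b_def)
  have "T a + ln (z - a) / L \<le> T b + ln (z - b) / L"
  proof (rule DERIV_nonneg_imp_nondecreasing[OF \<open>a \<le> b\<close>])
    fix r assume r: "a \<le> r" "r \<le> b"
    then have "r < z" using \<open>b < z\<close> by simp
    have "F r > 0" by (rule phase_interval_pos[OF cont \<open>F a > 0\<close> J[OF r(1) \<open>r < z\<close>]])
    moreover have "F r \<le> L * (z - r)" using lip[of r z] \<open>r < z\<close> Fz by simp
    ultimately have "1 / F r \<ge> 1 / (L * (z - r))" by (intro divide_left_mono) auto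
    moreover have "((\<lambda>b. T b + ln (z - b) / L) has_real_derivative 1 / F r - 1 / (L * (z - r))) (at r)"
    proof -
      have "((\<lambda>b. ln (z - b) / L) has_real_derivative - (1 / (L * (z - r)))) (at r)"
        using \<open>r < z\<close> \<open>L > 0\<close> by (auto intro!: derivative_eq_intros simp: field_simps)
      from DERIV_add[OF T[OF J[OF r(1) \<open>r < z\<close>]] this] show ?thesis by simp
    qed
    ultimately show "\<exists>y. ((\<lambda>b. T b + ln (z - b) / L) has_real_derivative y) (at r) \<and> y \<ge> 0"
      by force
  qed
  moreover have "ln (z - b) / L = ln (z - a) / L - K"
    using \<open>a < z\<close> \<open>L > 0\<close> by (simp add: b_def ln_mult diff_divide_distrib)
  ultimately have "T b \<ge> T a + K" by simp
  with J[OF \<open>a \<le> b\<close> \<open>b < z\<close>] \<open>a \<le> b\<close> show ?thesis by blast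
qed

text \<open>Reflection exchanges the two ends: the field \<open>\<lambda>u. F (- u)\<close> is
  positive at \<open>- a\<close> and has the time map \<open>\<lambda>b. - T (- b)\<close>.\<close>

lemma time_map_unbounded_below:
  assumes lip: "\<And>u v. \<bar>F u - F v\<bar> \<le> L * \<bar>u - v\<bar>" and bd: "\<And>u. \<bar>F u\<bar> \<le> M"
    and "L > 0" "M > 0" "F a > 0" "K \<ge> 0"
    and T: "\<And>b. b \<in> phase_interval F a \<Longrightarrow> (T has_real_derivative 1 / F b) (at b)"
  shows "\<exists>b\<le>a. b \<in> phase_interval F a \<and> T b \<le> T a - K"
proof -
  have "\<exists>b. b \<ge> - a \<and> b \<in> phase_interval (\<lambda>u. F (- u)) (- a) \<and> - T (- b) \<ge> - T (- (- a)) + K"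
  proof (rule time_map_unbounded_above[where L = L and M = M])
    show "\<bar>F (- u) - F (- v)\<bar> \<le> L * \<bar>u - v\<bar>" for u v
      using lip[of "- u" "- v"] by (simp add: abs_minus_commute)
    show "((\<lambda>b. - T (- b)) has_real_derivative 1 / F (- b)) (at b)"
      if "b \<in> phase_interval (\<lambda>u. F (- u)) (- a)" for b
      using T[of "- b"] that
      by (auto simp: phase_interval_mirror intro!: derivative_eq_intros DERIV_chain2[of T])
  qed (use assms in auto)
  then obtain b where "b \<ge> - a" "- b \<in> phase_interval F a" "T (- b) \<le> T a - K"
    by (auto simp: phase_interval_mirror)
  then show ?thesis by (intro exI[of _ "- b"]) auto
qed

lemma antiderivative_open_interval:
  fixes f :: "real \<Rightarrow> real"
  assumes "open S" "is_interval S" "continuous_on S f" "a \<in> S"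
  shows "\<exists>T. \<forall>b\<in>S. (T has_real_derivative f b) (at b)"
proof (intro exI ballI)
  fix b assume "b \<in> S"
  obtain e where e: "e > 0" "ball (min a b) e \<subseteq> S" "ball (max a b) e \<subseteq> S"
  proof -
    obtain d1 d2 where "d1 > 0" "ball (min a b) d1 \<subseteq> S" "d2 > 0" "ball (max a b) d2 \<subseteq> S"
      using \<open>open S\<close> \<open>a \<in> S\<close> \<open>b \<in> S\<close> unfolding open_contains_ball min_def max_def by metis
    then show ?thesis by (intro that[of "min d1 d2"]) (auto simp: subset_iff)
  qed
  \<comment> \<open>The compact interval \<open>{c..d}\<close> lies in \<open>S\<close> and has
    \<open>b\<close> in its interior, so the derivative within it that the fundamental theorem
    provides is a full derivative at \<open>b\<close>.\<close>
  define c d where "c = min a b - e / 2" and "d = max a b + e / 2"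
  have "c \<in> ball (min a b) e" "d \<in> ball (max a b) e"
    using e(1) by (simp_all add: c_def d_def dist_real_def)
  then have "c \<in> S" "d \<in> S" using e by blast+
  then have "{c..d} \<subseteq> S"
    using \<open>is_interval S\<close> unfolding is_interval_1 by (meson atLeastAtMost_iff subsetI)
  then have "((\<lambda>u. LBINT y=a..u. f y) has_vector_derivative f b) (at b within {c..d})"
    using e(1) by (intro interval_integral_FTC2 continuous_on_subset[OF assms(3)]) (auto simp: c_def d_def)
  moreover have "at b within {c..d} = at b"
    using e(1) by (intro at_within_interior) (auto simp: c_def d_def)
  ultimately show "((\<lambda>u. LBINT y=a..u. f y) has_real_derivative f b) (at b)"
    by (simp only: has_real_derivative_iff_has_vector_derivative)
qed

text \<open>Separation of variables: \<open>T\<close> is an antiderivative of \<open>1 / F\<close>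
  on the phase interval, and \<open>x t\<close> is the point with \<open>T (x t) = T a + t\<close>.
  Because \<open>T\<close> is unbounded at both ends, \<open>x\<close> is defined for all times and
  fills the phase interval.\<close>

lemma solution_exists_pos:
  assumes lip: "\<And>u v. \<bar>F u - F v\<bar> \<le> L * \<bar>u - v\<bar>" and bd: "\<And>u. \<bar>F u\<bar> \<le> M"
    and "L > 0" "M > 0" "F a > 0"
  shows "\<exists>x. solution F x \<and> x 0 = a \<and> range x = phase_interval F a \<and> strict_mono x"
proof -
  let ?J = "phase_interval F a"
  have cont: "continuous_on UNIV F" by (rule continuous_on_lipschitz_real[OF lip])
  have aJ: "a \<in> ?J" by (simp add: phase_interval_def)
  have opn: "open ?J" and ivl: "is_interval ?J"
    using phase_interval_open[OF cont] phase_interval_interval \<open>F a > 0\<close> by auto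
  have pos: "F b > 0" if "b \<in> ?J" for b
    by (rule phase_interval_pos[OF cont \<open>F a > 0\<close> that])
  have "continuous_on ?J (\<lambda>b. 1 / F b)"
  proof (intro continuous_on_divide continuous_on_const continuous_on_subset[OF cont])
    show "\<forall>b\<in>?J. F b \<noteq> 0" using pos by force
  qed simp
  from antiderivative_open_interval[OF opn ivl this aJ]
  obtain T where T: "\<And>b. b \<in> ?J \<Longrightarrow> (T has_real_derivative 1 / F b) (at b)" by blast
  have Tmono: "T b < T c" if "b \<in> ?J" "c \<in> ?J" "b < c" for b c
  proof (rule DERIV_pos_imp_increasing[OF \<open>b < c\<close>])
    fix r assume "b \<le> r" "r \<le> c"
    then have "r \<in> ?J" using mem_is_interval_1_I[OF ivl] that by blast
    then show "\<exists>y. (T has_real_derivative y) (at r) \<and> y > 0"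
      using T pos by (intro exI[of _ "1 / F r"]) auto
  qed
  have surj: "\<exists>b\<in>?J. T b = T a + t" for t
  proof -
    obtain b where b: "b \<le> a" "b \<in> ?J" "T b \<le> T a - \<bar>t\<bar>"
      using time_map_unbounded_below[OF lip bd assms(3-5) _ T, of "\<bar>t\<bar>"] by auto
    obtain c where c: "c \<ge> a" "c \<in> ?J" "T c \<ge> T a + \<bar>t\<bar>"
      using time_map_unbounded_above[OF lip bd assms(3-5) _ T, of "\<bar>t\<bar>"] by auto
    have sub: "r \<in> ?J" if "b \<le> r" "r \<le> c" for r
      using mem_is_interval_1_I[OF ivl b(2) c(2)] that by blast
    have "\<exists>r\<ge>b. r \<le> c \<and> T r = T a + t"
      using b c sub T by (intro IVT) (auto intro: DERIV_isCont)
    then show ?thesis using sub by blast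
  qed
  define x where "x = (\<lambda>t. SOME b. b \<in> ?J \<and> T b = T a + t)"
  have x: "x t \<in> ?J" "T (x t) = T a + t" for t
    using someI_ex[of "\<lambda>b. b \<in> ?J \<and> T b = T a + t"] surj[of t] by (auto simp: x_def)
  have inj: "b = c" if "b \<in> ?J" "c \<in> ?J" "T b = T c" for b c
    using Tmono[of b c] Tmono[of c b] that by (cases b c rule: linorder_cases) auto
  have mono: "strict_mono x"
  proof (rule strict_monoI)
    fix s t :: real assume "s < t"
    then have "T (x s) < T (x t)" by (simp add: x(2))
    then show "x s < x t"
      using Tmono[OF x(1)[of t] x(1)[of s]] by (cases "x s" "x t" rule: linorder_cases) simp_all
  qed
  have rng: "range x = ?J"
  proof
    show "range x \<subseteq> ?J" using x(1) by blast
    show "?J \<subseteq> range x"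
    proof
      fix b assume "b \<in> ?J"
      have "x (T b - T a) = b" 
        by (rule inj[OF x(1) \<open>b \<in> ?J\<close>]) (simp add: x(2))
      then show "b \<in> range x" by (metis rangeI)
    qed
  qed
  \<comment> \<open>A monotone function with open range has no jumps; this continuity is a premise
    of the inverse function rule below.\<close>
  have "continuous_on UNIV x"
  proof (rule continuous_onI_mono)
    show "open (range x)" using rng opn by simp
    show "x s \<le> x t" if "s \<le> t" for s t using strict_mono_leD[OF mono that] .
  qed
  then have isc: "isCont x t" for t by (simp add: continuous_on_eq_continuous_at)
  have "(x has_real_derivative F (x t)) (at t)" for t
  proof -
    have "(x has_real_derivative inverse (1 / F (x t))) (at t)"
    proof (rule DERIV_inverse_function[where f = "\<lambda>b. T b - T a" and a = "t - 1" and b = "t + 1"])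
      show "((\<lambda>b. T b - T a) has_real_derivative 1 / F (x t)) (at (x t))"
        using DERIV_diff[OF T[OF x(1)] DERIV_const] by simp
      show "1 / F (x t) \<noteq> 0" using pos[OF x(1), of t] by simp
    qed (simp_all add: x(2) isc)
    then show ?thesis by simp
  qed
  moreover have "x 0 = a" by (rule inj[OF x(1) aJ]) (simp add: x(2))
  ultimately show ?thesis using rng mono by (auto simp: solution_def)
qed

text \<open>The sign clause covers increasing, constant and decreasing solutions at once, so that
  solutions of two equations can later be matched uniformly. A negative field is reduced to a
  positive one by reversing time.\<close>

lemma solution_exists:
  assumes lip: "\<And>u v. \<bar>F u - F v\<bar> \<le> L * \<bar>u - v\<bar>" and bd: "\<And>u. \<bar>F u\<bar> \<le> M"
    and "L > 0" "M > 0"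
  obtains x where "solution F x" "x 0 = a" "range x = phase_interval F a"
    "\<And>s t. s < t \<Longrightarrow> sgn (x t - x s) = sgn (F a)"
proof (cases "F a" "0 :: real" rule: linorder_cases)
  case greater
  then obtain x where "solution F x" "x 0 = a" "range x = phase_interval F a" "strict_mono x"
    using solution_exists_pos[OF assms] by blast
  with greater show ?thesis by (intro that) (auto dest: strict_monoD)
next
  case equal
  then have "range (\<lambda>_. a) = phase_interval F a" by (auto simp: phase_interval_def)
  with equal show ?thesis by (intro that[of "\<lambda>_. a"] solution_const) auto
next
  case less
  have "\<bar>- F u - - F v\<bar> \<le> L * \<bar>u - v\<bar>" for u v
    using lip[of v u] by (simp add: abs_minus_commute)
  then obtain x where x: "solution (\<lambda>u. - F u) x" "x 0 = a" "range x = phase_interval F a" "strict_mono x"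
    using solution_exists_pos[of "\<lambda>u. - F u" L M a] assms less by (auto simp: phase_interval_uminus)
  have "range (\<lambda>t. x (- t)) = range x"
    by (auto simp: image_iff) (metis minus_minus)
  moreover have "sgn (x (- t) - x (- s)) = sgn (F a)" if "s < t" for s t
    using strict_monoD[OF x(4), of "- t" "- s"] that less by simp
  ultimately show ?thesis
    using x solution_reverse[OF x(1)] by (intro that[of "\<lambda>t. x (- t)"]) auto
qed

section \<open>Trajectories and topological equivalence\<close>

lemma C1_circle_lipschitz_bounded:
  assumes "f \<in> C1_circle"
  obtains L M :: real where "L > 0" "M > 0"
    "\<And>u v. \<bar>(f \<circ> circle_of) u - (f \<circ> circle_of) v\<bar> \<le> L * \<bar>u - v\<bar>"
    "\<And>u. \<bar>(f \<circ> circle_of) u\<bar> \<le> M"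
proof
  let ?A = "SUP p. \<bar>f p\<bar>" and ?B = "SUP x. \<bar>deriv (f \<circ> circle_of) x\<bar>"
  note bounds = C1_norm_bounds[OF assms]
  \<comment> \<open>The added 1 keeps the constants positive even when a supremum is 0.\<close>
  show "?B + 1 > 0" "?A + 1 > 0" using bounds(2,4) by auto
  show "\<bar>(f \<circ> circle_of) u\<bar> \<le> ?A + 1" for u
    using bounds(1)[of "circle_of u"] by simp
  show "\<bar>(f \<circ> circle_of) u - (f \<circ> circle_of) v\<bar> \<le> (?B + 1) * \<bar>u - v\<bar>" for u v
  proof -
    have "norm ((f \<circ> circle_of) u - (f \<circ> circle_of) v) \<le> (?B + 1) * norm (u - v)"
    proof (rule field_differentiable_bound[of UNIV])
      show "((f \<circ> circle_of) has_real_derivative deriv (f \<circ> circle_of) z) (at z within UNIV)" for z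
        using C1_circle_has_deriv(1)[OF assms] by simp
      show "norm (deriv (f \<circ> circle_of) z) \<le> ?B + 1" for z
        using bounds(3)[of z] by simp
    qed auto
    then show ?thesis by simp
  qed
qed

lemma trajectory_iff: "trajectory f \<gamma> \<longleftrightarrow> (\<exists>x. \<gamma> = circle_of \<circ> x \<and> solution (f \<circ> circle_of) x)"
  by (auto simp: trajectory_def solution_def)

lemma trajectory_shift:
  assumes "trajectory f \<gamma>"
  shows "trajectory f (\<lambda>t. \<gamma> (t + s))"
proof -
  obtain x where "\<gamma> = circle_of \<circ> x" "solution (f \<circ> circle_of) x"
    using assms by (auto simp: trajectory_iff)
  then show ?thesis
    unfolding trajectory_iff by (intro exI[of _ "\<lambda>t. x (t + s)"]) (auto intro: solution_shift)
qed

lemma circle_of_cases: obtains a where "p = circle_of a"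
  using surj_circle_of by (metis surjD)

lemma trajectory_exists:
  assumes "f \<in> C1_circle"
  shows "\<exists>\<gamma>. trajectory f \<gamma> \<and> \<gamma> 0 = p"
proof -
  obtain a where a: "p = circle_of a" by (rule circle_of_cases)
  obtain L M where "L > 0" "M > 0"
    "\<And>u v. \<bar>(f \<circ> circle_of) u - (f \<circ> circle_of) v\<bar> \<le> L * \<bar>u - v\<bar>"
    "\<And>u. \<bar>(f \<circ> circle_of) u\<bar> \<le> M"
    using C1_circle_lipschitz_bounded[OF assms] by blast
  then obtain x where "solution (f \<circ> circle_of) x" "x 0 = a"
    using solution_exists[of "f \<circ> circle_of" L M a] by metis
  then show ?thesis
    unfolding trajectory_iff a by (intro exI[of _ "circle_of \<circ> x"]) auto
qed

lemma solution_translate: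
  assumes "solution (f \<circ> circle_of) x" "n \<in> \<int>"
  shows "solution (f \<circ> circle_of) (\<lambda>t. x t + n)"
proof -
  have "circle_of (x t + n) = circle_of (x t)" for t
    using assms(2) by (simp add: circle_of_eq_iff)
  with assms(1) show ?thesis
    by (auto simp: solution_def intro!: derivative_eq_intros)
qed

text \<open>Lifts of the two trajectories differ at time \<open>s\<close> by an integer. Translating
  a lift by that integer gives another solution of the periodic equation, and uniqueness on the line
  applies.\<close>

lemma trajectory_unique:
  assumes f: "f \<in> C1_circle" and "trajectory f \<gamma>" "trajectory f \<eta>" "\<gamma> s = \<eta> s"
  shows "\<gamma> = \<eta>"
proof -
  obtain x y where x: "\<gamma> = circle_of \<circ> x" "solution (f \<circ> circle_of) x"
    and y: "\<eta> = circle_of \<circ> y" "solution (f \<circ> circle_of) y"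
    using assms by (auto simp: trajectory_iff)
  have n: "x s - y s \<in> \<int>" using assms(4) x y by (simp add: circle_of_eq_iff)
  obtain L M where "L > 0" "M > 0"
    and lip: "\<And>u v. \<bar>(f \<circ> circle_of) u - (f \<circ> circle_of) v\<bar> \<le> L * \<bar>u - v\<bar>"
    and "\<And>u. \<bar>(f \<circ> circle_of) u\<bar> \<le> M"
    using C1_circle_lipschitz_bounded[OF f] by blast
  have "x = (\<lambda>t. y t + (x s - y s))"
    by (rule solution_unique[OF lip x(2) solution_translate[OF y(2) n], of s]) simp
  then have "x t - y t \<in> \<int>" for t
    using n by (metis add_diff_cancel_left')
  then have "circle_of (x t) = circle_of (y t)" for t
    by (simp add: circle_of_eq_iff)
  then show ?thesis using x y by auto
qed

lemma orbit_eq_range: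
  assumes f: "f \<in> C1_circle" and \<gamma>: "trajectory f \<gamma>"
  shows "orbit f (\<gamma> 0) = range \<gamma>"
proof
  show "orbit f (\<gamma> 0) \<subseteq> range \<gamma>"
  proof
    fix p assume "p \<in> orbit f (\<gamma> 0)"
    then obtain \<eta> t where \<eta>: "trajectory f \<eta>" "\<eta> 0 = \<gamma> 0" "p = \<eta> t"
      by (auto simp: orbit_def)
    have "\<eta> = \<gamma>" by (rule trajectory_unique[OF f \<eta>(1) \<gamma> \<eta>(2)])
    with \<eta>(3) show "p \<in> range \<gamma>" by blast
  qed
  show "range \<gamma> \<subseteq> orbit f (\<gamma> 0)"
    using \<gamma> by (auto simp: orbit_def)
qed

text \<open>The orbit clause is obtained from the trajectory clause: by uniqueness an orbit is the
  range of a trajectory through the point, and a surjective change of time preserves ranges.\<close>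

lemma topologically_equivalentI:
  assumes f: "f \<in> C1_circle" and g: "g \<in> C1_circle" and "homeomorphism UNIV UNIV h h'"
    and tr: "\<And>\<gamma>. trajectory f \<gamma> \<Longrightarrow> \<exists>\<eta>. trajectory g \<eta> \<and> same_oriented_curve (h \<circ> \<gamma>) \<eta>"
  shows "topologically_equivalent f g"
proof -
  have "\<exists>q. h ` orbit f p = orbit g q" for p
  proof -
    obtain \<gamma> where \<gamma>: "trajectory f \<gamma>" "\<gamma> 0 = p" using trajectory_exists[OF f] by blast
    then obtain \<eta> \<tau> where \<eta>: "trajectory g \<eta>" "surj \<tau>" "h \<circ> \<gamma> = \<eta> \<circ> \<tau>"
      using tr[OF \<gamma>(1)] unfolding same_oriented_curve_def by blast
    have "h ` orbit f p = range (h \<circ> \<gamma>)"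
      using orbit_eq_range[OF f \<gamma>(1)] \<gamma>(2) by (simp add: image_comp)
    also have "\<dots> = range \<eta>" using \<eta>(2) by (metis \<eta>(3) image_comp)
    also have "\<dots> = orbit g (\<eta> 0)" using orbit_eq_range[OF g \<eta>(1)] by simp
    finally show ?thesis by blast
  qed
  with assms show ?thesis unfolding topologically_equivalent_def by blast
qed

text \<open>Given a trajectory \<open>\<eta>\<close> of \<open>g\<close>, start one of
  \<open>f\<close> at \<open>h' (\<eta> 0)\<close>. Its image under \<open>h\<close> runs along a
  trajectory of \<open>g\<close> that meets \<open>\<eta>\<close>, hence is a time shift of
  \<open>\<eta>\<close>; the change of time is then inverted.\<close>

lemma topologically_equivalent_sym:
  assumes f: "f \<in> C1_circle" and g: "g \<in> C1_circle" and "topologically_equivalent f g"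
  shows "topologically_equivalent g f"
proof -
  obtain h h' where hom: "homeomorphism UNIV UNIV h h'"
    and tr: "\<And>\<gamma>. trajectory f \<gamma> \<Longrightarrow> \<exists>\<eta>. trajectory g \<eta> \<and> same_oriented_curve (h \<circ> \<gamma>) \<eta>"
    using assms(3) unfolding topologically_equivalent_def by blast
  have hh': "h (h' p) = p" "h' (h p) = p" for p
    using hom by (auto simp: homeomorphism_def)
  show ?thesis
  proof (rule topologically_equivalentI[OF g f homeomorphism_symD[OF hom]])
    fix \<eta> assume \<eta>: "trajectory g \<eta>"
    obtain \<gamma> where \<gamma>: "trajectory f \<gamma>" "\<gamma> 0 = h' (\<eta> 0)" using trajectory_exists[OF f] by blast
    obtain \<zeta> \<tau> where \<zeta>: "trajectory g \<zeta>" and \<tau>: "strict_mono \<tau>" "surj \<tau>" and eq: "h \<circ> \<gamma> = \<zeta> \<circ> \<tau>"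
      using tr[OF \<gamma>(1)] by (auto simp: same_oriented_curve_def)
    have "\<zeta> (0 + \<tau> 0) = \<eta> 0" using fun_cong[OF eq, of 0] \<gamma>(2) hh' by simp
    from trajectory_unique[OF g trajectory_shift[OF \<zeta>] \<eta> this]
    have \<eta>_eq: "\<eta> t = \<zeta> (t + \<tau> 0)" for t by metis
    \<comment> \<open>The shift by \<open>\<tau> 0\<close> aligns \<open>\<zeta>\<close> with
      \<open>\<eta>\<close>, which need not be at the same point at time 0.\<close>
    define \<sigma> where "\<sigma> = (\<lambda>t. inv \<tau> (t + \<tau> 0))"
    have \<tau>\<sigma>: "\<tau> (\<sigma> t) = t + \<tau> 0" for t using \<tau>(2) by (simp add: \<sigma>_def surj_f_inv_f)
    have "strict_mono \<sigma>"
    proof (rule strict_monoI)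
      fix s t :: real assume "s < t"
      then have "\<tau> (\<sigma> s) < \<tau> (\<sigma> t)" by (simp add: \<tau>\<sigma>)
      then show "\<sigma> s < \<sigma> t" using strict_mono_less[OF \<tau>(1)] by blast
    qed
    moreover have "surj \<sigma>"
    proof (rule surjI)
      fix s
      have "\<tau> (\<sigma> (\<tau> s - \<tau> 0)) = \<tau> s" by (simp add: \<tau>\<sigma>)
      then show "\<sigma> (\<tau> s - \<tau> 0) = s" using strict_mono_eq[OF \<tau>(1)] by blast
    qed
    moreover have "h' \<circ> \<eta> = \<gamma> \<circ> \<sigma>"
    proof
      fix t
      have "\<eta> t = h (\<gamma> (\<sigma> t))" using fun_cong[OF eq, of "\<sigma> t"] by (simp add: \<tau>\<sigma> \<eta>_eq)
      then show "(h' \<circ> \<eta>) t = (\<gamma> \<circ> \<sigma>) t" by (simp add: hh')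
    qed
    ultimately show "\<exists>\<gamma>. trajectory f \<gamma> \<and> same_oriented_curve (h' \<circ> \<eta>) \<gamma>"
      using \<gamma>(1) unfolding same_oriented_curve_def by blast
  qed
qed

lemma topologically_equivalent_trans:
  assumes "f \<in> C1_circle" "k \<in> C1_circle"
    and fg: "topologically_equivalent f g" and gk: "topologically_equivalent g k"
  shows "topologically_equivalent f k"
proof -
  obtain h h' where h: "homeomorphism UNIV UNIV h h'"
    "\<And>\<gamma>. trajectory f \<gamma> \<Longrightarrow> \<exists>\<eta>. trajectory g \<eta> \<and> same_oriented_curve (h \<circ> \<gamma>) \<eta>"
    using fg unfolding topologically_equivalent_def by blast
  obtain j j' where j: "homeomorphism UNIV UNIV j j'"
    "\<And>\<gamma>. trajectory g \<gamma> \<Longrightarrow> \<exists>\<eta>. trajectory k \<eta> \<and> same_oriented_curve (j \<circ> \<gamma>) \<eta>"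
    using gk unfolding topologically_equivalent_def by blast
  show ?thesis
  proof (rule topologically_equivalentI[OF assms(1,2) homeomorphism_compose[OF h(1) j(1)]])
    fix \<gamma> assume "trajectory f \<gamma>"
    then obtain \<eta> \<sigma> where \<eta>: "trajectory g \<eta>" "strict_mono \<sigma>" "surj \<sigma>" "h \<circ> \<gamma> = \<eta> \<circ> \<sigma>"
      using h(2) unfolding same_oriented_curve_def by blast
    obtain \<zeta> \<tau> where \<zeta>: "trajectory k \<zeta>" "strict_mono \<tau>" "surj \<tau>" "j \<circ> \<eta> = \<zeta> \<circ> \<tau>"
      using j(2)[OF \<eta>(1)] unfolding same_oriented_curve_def by blast
    have "strict_mono (\<tau> \<circ> \<sigma>)" using \<eta>(2) \<zeta>(2) by (simp add: strict_mono_def)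
    moreover have "surj (\<tau> \<circ> \<sigma>)" using \<eta>(3) \<zeta>(3) by (rule comp_surj)
    moreover have "(j \<circ> h) \<circ> \<gamma> = \<zeta> \<circ> (\<tau> \<circ> \<sigma>)" using \<eta>(4) \<zeta>(4) by (metis comp_assoc)
    ultimately show "\<exists>\<zeta>. trajectory k \<zeta> \<and> same_oriented_curve ((j \<circ> h) \<circ> \<gamma>) \<zeta>"
      using \<zeta>(1) unfolding same_oriented_curve_def by blast
  qed
qed

section \<open>Openness of the set of stable fields\<close>

lemma structurally_stable_iff:
  "structurally_stable f \<longleftrightarrow> (\<exists>\<epsilon>>0. \<forall>g\<in>C1_ball f \<epsilon>. topologically_equivalent f g)"
proof
  assume "structurally_stable f"
  then obtain b where b: "b > 0" "\<And>\<epsilon>. 0 < \<epsilon> \<Longrightarrow> \<epsilon> < b \<Longrightarrow> \<forall>g\<in>C1_ball f \<epsilon>. topologically_equivalent f g"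
    unfolding structurally_stable_def eventually_at_right_field by blast
  from b(2)[of "b / 2"] b(1) show "\<exists>\<epsilon>>0. \<forall>g\<in>C1_ball f \<epsilon>. topologically_equivalent f g"
    by (intro exI[of _ "b / 2"]) simp
next
  assume "\<exists>\<epsilon>>0. \<forall>g\<in>C1_ball f \<epsilon>. topologically_equivalent f g"
  then obtain b where b: "b > 0" "\<forall>g\<in>C1_ball f b. topologically_equivalent f g" by blast
  then show "structurally_stable f"
    unfolding structurally_stable_def eventually_at_right_field
    by (intro exI[of _ b]) (auto simp: C1_ball_def)
qed

text \<open>Half the stability radius of \<open>f\<close> serves twice: for \<open>g\<close> in that
  ball around \<open>f\<close> and \<open>k\<close> in that ball around \<open>g\<close>, both
  \<open>g\<close> and \<open>k\<close> are equivalent to \<open>f\<close>, hence to each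
  other.\<close>

lemma openin_SS1: "openin C1_topology SS1"
  unfolding openin_C1_topology
proof (intro conjI ballI)
  show "SS1 \<subseteq> C1_circle" by (auto simp: SS1_def)
  fix f assume "f \<in> SS1"
  then obtain \<epsilon> where f: "f \<in> C1_circle" and "\<epsilon> > 0"
    and eq: "\<And>g. g \<in> C1_ball f \<epsilon> \<Longrightarrow> topologically_equivalent f g"
    by (auto simp: SS1_def structurally_stable_iff)
  have "g \<in> SS1" if g: "g \<in> C1_ball f (\<epsilon> / 2)" for g
  proof -
    have gC: "g \<in> C1_circle" and fg: "topologically_equivalent f g"
      using g \<open>\<epsilon> > 0\<close> eq by (auto simp: C1_ball_def)
    have "topologically_equivalent g k" if k: "k \<in> C1_ball g (\<epsilon> / 2)" for k
    proof -
      have kC: "k \<in> C1_circle" using k by (simp add: C1_ball_def)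
      have "k \<in> C1_ball f \<epsilon>"
        using C1_norm_triangle[OF kC gC f] g k by (auto simp: C1_ball_def)
      then show ?thesis
        using topologically_equivalent_trans[OF gC kC topologically_equivalent_sym[OF f gC fg]] eq
        by blast
    qed
    then show ?thesis
      using gC \<open>\<epsilon> > 0\<close> unfolding SS1_def structurally_stable_iff
      by (auto intro!: exI[of _ "\<epsilon> / 2"])
  qed
  then show "\<exists>\<epsilon>>0. C1_ball f \<epsilon> \<subseteq> SS1"
    using \<open>\<epsilon> > 0\<close> by (intro exI[of _ "\<epsilon> / 2"]) auto
qed

section \<open>Circle homeomorphisms from lifts\<close>

lemma circle_of_rep_circle: "circle_of (rep_circle p) = p"
  by (rule Quotient3_abs_rep[OF Quotient3_circle])

lemma degree_one_int:
  assumes "\<And>x :: real. H (x + 1) = H x + (1 :: real)" "n \<in> \<int>"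
  shows "H (x + n) = H x + n"
proof -
  have nat: "H (x + real k) = H x + real k" for x k
  proof (induction k)
    case (Suc k)
    then show ?case using assms(1)[of "x + real k"] by (simp add: add_ac)
  qed simp
  obtain k where "n = of_int k" using assms(2) by (auto elim: Ints_cases)
  then show ?thesis
    \<comment> \<open>A negative \<open>n\<close> is handled by going up from \<open>x + n\<close>
      to \<open>x\<close> in \<open>- k\<close> unit steps.\<close>
    using nat[of x "nat k"] nat[of "x + n" "nat (- k)"] by (cases "k \<ge> 0") auto
qed

definition circle_map :: "(real \<Rightarrow> real) \<Rightarrow> circle \<Rightarrow> circle" where
  "circle_map H p = circle_of (H (rep_circle p))"

text \<open>Independence of the representative: two of them differ by an integer, and a map of
  degree one passes this integer on to its values.\<close>

lemma circle_map_circle_of: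
  assumes "\<And>x. H (x + 1) = H x + 1"
  shows "circle_map H (circle_of x) = circle_of (H x)"
proof -
  define n where "n = rep_circle (circle_of x) - x"
  have n: "n \<in> \<int>"
    unfolding n_def by (metis circle_of_eq_iff circle_of_rep_circle)
  have "H (rep_circle (circle_of x)) = H x + n"
    using degree_one_int[of H, OF assms n, of x] by (simp add: n_def)
  then show ?thesis using n by (simp add: circle_map_def circle_of_eq_iff)
qed

lemma continuous_on_circle_map:
  assumes "\<And>x. H (x + 1) = H x + 1" "continuous_on UNIV H"
  shows "continuous_on UNIV (circle_map H)"
proof -
  have "open (circle_map H -` U)" if "open U" for U
  proof -
    have "circle_of -` (circle_map H -` U) = H -` (circle_of -` U)"
      by (auto simp: circle_map_circle_of[of H, OF assms(1)])
    also have "open \<dots>"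
      using that by (intro open_vimage[OF _ assms(2)]) (simp add: open_circle_def)
    finally show ?thesis by (simp add: open_circle_def)
  qed
  then show ?thesis by (simp add: continuous_on_open_vimage)
qed

lemma continuous_strict_mono_surj:
  fixes H :: "real \<Rightarrow> real"
  assumes "strict_mono H" "surj H"
  shows "continuous_on UNIV H"
proof (rule continuous_onI_mono)
  show "open (range H)" using assms(2) by simp
  show "H x \<le> H y" if "x \<le> y" for x y using strict_mono_leD[OF assms(1) that] .
qed

lemma homeomorphism_circle_map:
  assumes mono: "strict_mono H" and surj: "surj H" and per: "\<And>x. H (x + 1) = H x + 1"
  shows "homeomorphism UNIV UNIV (circle_map H) (circle_map (inv H))"
proof -
  have HK: "H (inv H y) = y" for y using surj by (rule surj_f_inv_f)
  have KH: "inv H (H y) = y" for y using strict_mono_imp_inj_on[OF mono] by simp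
  have mono': "strict_mono (inv H)"
    using strict_mono_less[OF mono] HK by (metis strict_mono_def)
  have surj': "surj (inv H)" using KH by (metis surjI)
  have per': "inv H (y + 1) = inv H y + 1" for y
  proof -
    have "H (inv H y + 1) = y + 1" by (simp add: per HK)
    then show ?thesis by (metis KH)
  qed
  note simps = circle_map_circle_of[of H, OF per] circle_map_circle_of[of "inv H", OF per']
  show ?thesis
  proof (rule homeomorphismI)
    show "continuous_on UNIV (circle_map H)"
      by (rule continuous_on_circle_map[of H, OF per continuous_strict_mono_surj[OF mono surj]])
    show "continuous_on UNIV (circle_map (inv H))"
      by (rule continuous_on_circle_map[of "inv H", OF per' continuous_strict_mono_surj[OF mono' surj']])
    show "circle_map (inv H) (circle_map H p) = p" for p
      using circle_of_cases[of p] by (metis KH simps)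
    show "circle_map H (circle_map (inv H) p) = p" for p
      using circle_of_cases[of p] by (metis HK simps)
  qed auto
qed

section \<open>Lifts that match signs induce topological equivalences\<close>

lemma strict_mono_image_segment:
  fixes H :: "real \<Rightarrow> real"
  assumes mono: "strict_mono H" and surj: "surj H"
  shows "H ` closed_segment a b = closed_segment (H a) (H b)"
proof -
  have "z \<in> closed_segment a b \<longleftrightarrow> H z \<in> closed_segment (H a) (H b)" for z
    by (auto simp: closed_segment_eq_real_ivl strict_mono_less_eq[OF mono] strict_mono_less[OF mono])
  then show ?thesis using surj by (auto simp: image_iff) (metis surjD)
qed

text \<open>\<open>H\<close> carries segments onto segments and, by the sign condition, zeros of
  \<open>F\<close> exactly to zeros of \<open>G\<close>.\<close>

lemma phase_interval_image:
  assumes mono: "strict_mono H" and surj: "surj H" and sgn: "\<And>x. sgn (G (H x)) = sgn (F x :: real)"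
  shows "H ` phase_interval F a = phase_interval G (H a)"
proof -
  have "b \<in> phase_interval F a \<longleftrightarrow> H b \<in> phase_interval G (H a)" for b
  proof -
    have "G (H z) = 0 \<longleftrightarrow> F z = 0" for z using sgn[of z] by (metis sgn_eq_0_iff)
    then show ?thesis
      by (auto simp: phase_interval_def strict_mono_eq[OF mono]
          strict_mono_image_segment[OF mono surj, symmetric])
  qed
  then show ?thesis using surj by (auto simp: image_iff) (metis surjD)
qed

text \<open>For \<open>c = 0\<close> both curves are constant. Otherwise \<open>v\<close> is
  injective and \<open>\<tau>\<close> is \<open>u\<close> followed by the inverse of
  \<open>v\<close>; it increases because \<open>u\<close> and \<open>v\<close> move in the same
  direction.\<close>

lemma monotone_reparametrization:
  fixes u v :: "real \<Rightarrow> real"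
  assumes "range u = range v"
    and u: "\<And>s t. s < t \<Longrightarrow> sgn (u t - u s) = c" and v: "\<And>s t. s < t \<Longrightarrow> sgn (v t - v s) = c"
  shows "\<exists>\<tau>. strict_mono \<tau> \<and> surj \<tau> \<and> u = v \<circ> \<tau>"
proof (cases "c = 0")
  case True
  have "w s = w 0" if "\<And>s t. s < t \<Longrightarrow> sgn (w t - w s) = c" for w :: "real \<Rightarrow> real" and s
    using that[of s 0] that[of 0 s] True by (cases s "0 :: real" rule: linorder_cases) (auto simp: sgn_0_0)
  then have "u t = u 0" "v t = v 0" for t using u v by blast+
  then have "u = (\<lambda>_. u 0)" "v = (\<lambda>_. v 0)" by auto
  with \<open>range u = range v\<close> have "u = v" by (metis rangeE rangeI)
  then show ?thesis by (intro exI[of _ id]) (auto simp: strict_mono_def)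
next
  case False
  define \<tau> where "\<tau> = (\<lambda>t. SOME s. v s = u t)"
  have v\<tau>: "v (\<tau> t) = u t" for t
  proof -
    have "\<exists>s. v s = u t" using \<open>range u = range v\<close> by (metis rangeE rangeI)
    then show ?thesis unfolding \<tau>_def by (rule someI_ex)
  qed
  have inj: "s = t" if "v s = v t" for s t
    using v[of s t] v[of t s] that False by (cases s t rule: linorder_cases) auto
  have "strict_mono \<tau>"
  proof (rule strict_monoI)
    fix s t :: real assume "s < t"
    then have c: "sgn (v (\<tau> t) - v (\<tau> s)) = c" using u by (simp add: v\<tau>)
    show "\<tau> s < \<tau> t"
    proof (rule ccontr)
      assume "\<not> \<tau> s < \<tau> t"
      then consider "\<tau> t = \<tau> s" | "\<tau> t < \<tau> s" by linarith
      then show False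
      proof cases
        case 1
        then show False using c False by simp
      next
        case 2
        from v[OF this] have "sgn (v (\<tau> s) - v (\<tau> t)) = c" .
        with c False show False by (auto simp: sgn_if split: if_splits)
      qed
    qed
  qed
  moreover have "surj \<tau>"
  proof -
    have "\<exists>t. \<tau> t = s" for s
    proof -
      obtain t where "u t = v s" using \<open>range u = range v\<close> by (metis rangeE rangeI)
      then have "v (\<tau> t) = v s" by (simp add: v\<tau>)
      then show ?thesis using inj by blast
    qed
    then show ?thesis by (metis surjI)
  qed
  ultimately show ?thesis using v\<tau> by (intro exI[of _ \<tau>]) auto
qed

text \<open>The image \<open>H \<circ> x\<close> of a solution and the solution \<open>y\<close>
  starting at \<open>H (x 0)\<close> traverse the same phase interval in the same direction, so they
  differ by an increasing change of time.\<close>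

lemma topologically_equivalent_by_lift:
  assumes f: "f \<in> C1_circle" and g: "g \<in> C1_circle"
    and mono: "strict_mono H" and surj: "surj H" and per: "\<And>x. H (x + 1) = H x + 1"
    and sgn: "\<And>x. sgn (g (circle_of (H x))) = sgn (f (circle_of x))"
  shows "topologically_equivalent f g"
proof (rule topologically_equivalentI[OF f g homeomorphism_circle_map[OF mono surj per]])
  fix \<gamma> assume "trajectory f \<gamma>"
  then obtain x where x: "\<gamma> = circle_of \<circ> x" "solution (f \<circ> circle_of) x"
    by (auto simp: trajectory_iff)
  obtain L M where F: "L > 0" "M > 0"
    "\<And>u v. \<bar>(f \<circ> circle_of) u - (f \<circ> circle_of) v\<bar> \<le> L * \<bar>u - v\<bar>"
    "\<And>u. \<bar>(f \<circ> circle_of) u\<bar> \<le> M"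
    using C1_circle_lipschitz_bounded[OF f] by blast
  obtain L' M' where G: "L' > 0" "M' > 0"
    "\<And>u v. \<bar>(g \<circ> circle_of) u - (g \<circ> circle_of) v\<bar> \<le> L' * \<bar>u - v\<bar>"
    "\<And>u. \<bar>(g \<circ> circle_of) u\<bar> \<le> M'"
    using C1_circle_lipschitz_bounded[OF g] by blast
  obtain x' where x': "solution (f \<circ> circle_of) x'" "x' 0 = x 0"
    "range x' = phase_interval (f \<circ> circle_of) (x 0)"
    "\<And>s t. s < t \<Longrightarrow> sgn (x' t - x' s) = sgn ((f \<circ> circle_of) (x 0))"
    using solution_exists[OF F(3,4,1,2), of "x 0"] by blast
  \<comment> \<open>Uniqueness transfers the range and direction of the constructed solution to the
    given one.\<close>
  have "x' = x" by (rule solution_unique[OF F(3) x'(1) x(2) x'(2)])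
  obtain y where y: "solution (g \<circ> circle_of) y" "y 0 = H (x 0)"
    "range y = phase_interval (g \<circ> circle_of) (H (x 0))"
    "\<And>s t. s < t \<Longrightarrow> sgn (y t - y s) = sgn ((g \<circ> circle_of) (H (x 0)))"
    using solution_exists[OF G(3,4,1,2), of "H (x 0)"] by blast
  have "\<exists>\<tau>. strict_mono \<tau> \<and> surj \<tau> \<and> H \<circ> x = y \<circ> \<tau>"
  proof (rule monotone_reparametrization)
    have "range (H \<circ> x) = H ` phase_interval (f \<circ> circle_of) (x 0)"
      using x'(3) \<open>x' = x\<close> by (metis image_comp)
    also have "\<dots> = range y"
      unfolding y(3) by (rule phase_interval_image[OF mono surj]) (simp add: sgn)
    finally show "range (H \<circ> x) = range y" .
    have sgnH: "sgn (H b - H a) = sgn (b - a)" for a b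
      using strict_mono_less[OF mono, of a b] strict_mono_less[OF mono, of b a]
      by (auto simp: sgn_if)
    show "sgn ((H \<circ> x) t - (H \<circ> x) s) = sgn (f (circle_of (x 0)))" if "s < t" for s t
      using x'(4)[OF that] \<open>x' = x\<close> by (simp add: sgnH)
    show "sgn (y t - y s) = sgn (f (circle_of (x 0)))" if "s < t" for s t
      using y(4)[OF that] by (simp add: sgn)
  qed
  then obtain \<tau> where \<tau>: "strict_mono \<tau>" "surj \<tau>" "H \<circ> x = y \<circ> \<tau>" by blast
  have "circle_map H \<circ> \<gamma> = (circle_of \<circ> y) \<circ> \<tau>"
    using fun_cong[OF \<tau>(3)] by (auto simp: x(1) circle_map_circle_of[of H, OF per])
  then show "\<exists>\<eta>. trajectory g \<eta> \<and> same_oriented_curve (circle_map H \<circ> \<gamma>) \<eta>"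
    using \<tau> y(1) unfolding same_oriented_curve_def trajectory_iff by blast
qed

section \<open>Conjugating functions monotone on the same gaps\<close>

lemma gap_around_point:
  fixes K :: "real set"
  assumes "closed K" and below: "\<And>x. \<exists>a\<in>K. a \<le> x" and above: "\<And>x. \<exists>b\<in>K. x \<le> b"
    and "x \<notin> K"
  obtains a b where "a \<in> K" "b \<in> K" "a < x" "x < b" "{a<..<b} \<inter> K = {}"
proof -
  let ?A = "K \<inter> {..x}" and ?B = "K \<inter> {x..}"
  have A: "Sup ?A \<in> ?A"
    using below[of x] assms(1) by (intro closed_contains_Sup) (auto simp: closed_Int)
  have B: "Inf ?B \<in> ?B"
    using above[of x] assms(1) by (intro closed_contains_Inf) (auto simp: closed_Int)
  have "Sup ?A < x" "x < Inf ?B" using A B \<open>x \<notin> K\<close> by (auto simp: less_le)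
  moreover have "k \<notin> K" if k: "Sup ?A < k" "k < Inf ?B" for k
  proof
    assume "k \<in> K"
    show False
    proof (cases "k \<le> x")
      case True
      then have "k \<le> Sup ?A" using \<open>k \<in> K\<close> by (intro cSup_upper) auto
      with k show False by simp
    next
      case False
      then have "Inf ?B \<le> k" using \<open>k \<in> K\<close> by (intro cInf_lower) auto
      with k show False by simp
    qed
  qed
  ultimately show ?thesis using A B by (intro that[of "Sup ?A" "Inf ?B"]) auto
qed

text \<open>
  The conjugating map fixes \<open>K\<close> and sends each gap of \<open>K\<close> to itself by \<open>B\<inverse> \<circ> A\<close>; \<open>near x y\<close> says
  that \<open>x\<close> and \<open>y\<close> are equal or in the same gap.
\<close>

locale gapwise_comonotone =
  fixes A B :: "real \<Rightarrow> real" and K :: "real set"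
  assumes contA: "continuous_on UNIV A" and contB: "continuous_on UNIV B" and closedK: "closed K"
    and below: "\<And>x. \<exists>a\<in>K. a \<le> x" and above: "\<And>x. \<exists>b\<in>K. x \<le> b"
    and eqK: "\<And>x. x \<in> K \<Longrightarrow> A x = B x"
    and comono: "\<And>a b. {a<..<b} \<inter> K = {} \<Longrightarrow>
      \<exists>\<sigma>. \<forall>x y. a \<le> x \<and> x < y \<and> y \<le> b \<longrightarrow> \<sigma> * (A y - A x) > 0 \<and> \<sigma> * (B y - B x) > 0"
    and perA: "\<And>x. A (x + 1) = A x" and perB: "\<And>x. B (x + 1) = B x"
    and perK: "\<And>x. x + 1 \<in> K \<longleftrightarrow> x \<in> K"
begin

definition near :: "real \<Rightarrow> real \<Rightarrow> bool" where
  "near x y \<longleftrightarrow> x = y \<or> (\<forall>k\<in>K. (k < x \<and> k < y) \<or> (x < k \<and> y < k))"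

lemma near_translate: "near x y \<Longrightarrow> near (x + 1) (y + 1)"
  unfolding near_def
proof (elim disjE, goal_cases)
  case 2
  have "k - 1 \<in> K" if "k \<in> K" for k using that perK[of "k - 1"] by simp
  with 2 show ?case by force
qed simp

text \<open>At the ends of the gap around \<open>x\<close> the functions agree, and strict
  monotonicity puts \<open>A x\<close> strictly between the end values. So \<open>B\<close> attains
  it there, and only at an interior point of the gap.\<close>

lemma near_exists: "\<exists>y. near x y \<and> B y = A x"
proof (cases "x \<in> K")
  case True
  then show ?thesis using eqK by (intro exI[of _ x]) (auto simp: near_def)
next
  case False
  then obtain a b where ab: "a \<in> K" "b \<in> K" "a < x" "x < b" "{a<..<b} \<inter> K = {}"
    using gap_around_point[OF closedK below above] by blast
  obtain \<sigma> where \<sigma>: "\<forall>x y. a \<le> x \<and> x < y \<and> y \<le> b \<longrightarrow> \<sigma> * (A y - A x) > 0 \<and> \<sigma> * (B y - B x) > 0"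
    using comono[OF ab(5)] by blast
  have 1: "\<sigma> * (A x - A a) > 0" "\<sigma> * (A b - A x) > 0" using \<sigma> ab by auto
  then have "A x \<noteq> B a" "A x \<noteq> B b" using eqK ab by auto
  have "(A x - A a > 0 \<and> A b - A x > 0) \<or> (A x - A a < 0 \<and> A b - A x < 0)"
    using 1 by (auto simp: zero_less_mult_iff)
  then have "A x \<in> closed_segment (B a) (B b)"
    using eqK ab by (auto simp: closed_segment_eq_real_ivl)
  then obtain y where y: "y \<in> closed_segment a b" "B y = A x"
    using IVT'_closed_segment_real[of "A x" B a b] continuous_on_subset[OF contB] by blast
  then have "a < y" "y < b"
    using \<open>A x \<noteq> B a\<close> \<open>A x \<noteq> B b\<close> ab by (auto simp: closed_segment_eq_real_ivl less_le)
  have "\<forall>k\<in>K. k \<le> a \<or> b \<le> k" using ab(5) by force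
  then have "near x y" unfolding near_def using \<open>a < y\<close> \<open>y < b\<close> ab(3,4) by force
  with y show ?thesis by blast
qed

text \<open>No point of \<open>K\<close> lies strictly between two points near \<open>x\<close>, so
  \<open>B\<close> is strictly monotone on the interval they span.\<close>

lemma near_inj:
  assumes "near x y" "near x z" "B y = B z"
  shows "y = z"
proof (rule ccontr)
  assume "y \<noteq> z"
  have "{min y z<..<max y z} \<inter> K = {}"
    using assms(1,2) unfolding near_def by force
  from comono[OF this] obtain \<sigma> where
    \<sigma>: "\<forall>u v. min y z \<le> u \<and> u < v \<and> v \<le> max y z \<longrightarrow> \<sigma> * (A v - A u) > 0 \<and> \<sigma> * (B v - B u) > 0"
    by blast
  show False
    using \<sigma>[rule_format, of y z] \<sigma>[rule_format, of z y] \<open>y \<noteq> z\<close> assms(3)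
    by (cases y z rule: linorder_cases) auto
qed

definition conj_map :: "real \<Rightarrow> real" where
  "conj_map x = (THE y. near x y \<and> B y = A x)"

lemma conj_map: "near x (conj_map x)" "B (conj_map x) = A x"
proof -
  have "\<exists>!y. near x y \<and> B y = A x" using near_exists[of x] near_inj by metis
  from theI'[OF this] show "near x (conj_map x)" "B (conj_map x) = A x"
    by (auto simp: conj_map_def)
qed

lemma conj_map_unique:
  assumes "near x y" "B y = A x"
  shows "conj_map x = y"
  by (rule near_inj[OF conj_map(1) assms(1)]) (simp only: conj_map(2) assms(2))

lemma conj_map_translate: "conj_map (x + 1) = conj_map x + 1"
proof (rule conj_map_unique)
  show "near (x + 1) (conj_map x + 1)" by (rule near_translate[OF conj_map(1)])
  show "B (conj_map x + 1) = A (x + 1)" by (simp only: perA perB conj_map(2))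
qed

text \<open>A point of \<open>K\<close> in \<open>[x, x']\<close> separates the images, since
  \<open>near\<close> keeps each point on its side. Otherwise \<open>x\<close>, \<open>x'\<close>
  and their images lie in one closed interval with \<open>K\<close>-free interior; there
  \<open>A\<close> and \<open>B\<close> are monotone in the same direction, so
  \<open>B y = A x\<close> and \<open>B y' = A x'\<close> force the order.\<close>

lemma strict_mono_conj_map: "strict_mono conj_map"
proof (rule strict_monoI, rule ccontr)
  fix x x' :: real
  define y y' where "y = conj_map x" and "y' = conj_map x'"
  have near: "near x y" "near x' y'" and B: "B y = A x" "B y' = A x'"
    using conj_map by (simp_all add: y_def y'_def)
  assume "x < x'" "\<not> conj_map x < conj_map x'"
  then have "y' \<le> y" by (simp add: y_def y'_def)
  show False
  proof (cases "\<exists>k\<in>K. x \<le> k \<and> k \<le> x'")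
    case True
    then show False using near \<open>x < x'\<close> \<open>y' \<le> y\<close> unfolding near_def by force
  next
    case False
    let ?a = "min x y'" and ?b = "max x' y"
    have "\<not> (?a < k \<and> k < ?b)" if "k \<in> K" for k
    proof -
      have "k < x \<or> x' < k" using False that by force
      moreover have "x = y \<or> (k < x \<and> k < y) \<or> (x < k \<and> y < k)"
        "x' = y' \<or> (k < x' \<and> k < y') \<or> (x' < k \<and> y' < k)"
        using near that by (auto simp only: near_def)
      ultimately show ?thesis using \<open>x < x'\<close> by linarith
    qed
    then have "{?a<..<?b} \<inter> K = {}" by auto
    from comono[OF this] obtain \<sigma> where
      \<sigma>: "\<And>u v. ?a \<le> u \<Longrightarrow> u < v \<Longrightarrow> v \<le> ?b \<Longrightarrow> \<sigma> * (A v - A u) > 0 \<and> \<sigma> * (B v - B u) > 0"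
      by blast
    have "\<sigma> * (B y' - B y) > 0" using \<sigma>[of x x'] \<open>x < x'\<close> B by simp
    moreover have "\<sigma> * (B y - B y') \<ge> 0"
      using \<sigma>[of y' y] \<open>y' \<le> y\<close> by (cases "y' = y") auto
    ultimately show False by (simp add: algebra_simps)
  qed
qed

end

text \<open>This symmetry yields surjectivity: \<open>near\<close> is symmetric, so a preimage under
  \<open>conj_map\<close> is what \<open>near_exists\<close> provides with \<open>A\<close> and
  \<open>B\<close> exchanged.\<close>

lemma (in gapwise_comonotone) flip: "gapwise_comonotone B A K"
proof
  fix a b :: real assume "{a<..<b} \<inter> K = {}"
  from comono[OF this] obtain \<sigma> where
    "\<forall>x y. a \<le> x \<and> x < y \<and> y \<le> b \<longrightarrow> \<sigma> * (A y - A x) > 0 \<and> \<sigma> * (B y - B x) > 0" ..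
  then show "\<exists>\<sigma>. \<forall>x y. a \<le> x \<and> x < y \<and> y \<le> b \<longrightarrow> \<sigma> * (B y - B x) > 0 \<and> \<sigma> * (A y - A x) > 0"
    by blast
qed (fact contA contB closedK below above eqK[symmetric] perA perB perK)+

lemma (in gapwise_comonotone) surj_conj_map: "surj conj_map"
proof -
  interpret flip: gapwise_comonotone B A K by (rule flip)
  have "\<exists>x. conj_map x = y" for y
  proof -
    obtain x where "flip.near y x" "A x = B y" using flip.near_exists by blast
    then have "conj_map x = y"
      by (intro conj_map_unique) (auto simp: near_def flip.near_def)
    then show ?thesis by blast
  qed
  then show ?thesis by (metis surjI)
qed

section \<open>Simple zeros\<close>

text \<open>By periodicity and compactness the sum of the absolute values of the lift and its
  derivative attains a minimum, positive because the zeros are simple. Half of it is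
  \<open>m\<close>: if the first summand is at most half the minimum, the second is at least
  that.\<close>

lemma simple_zeros_gap:
  assumes f: "f \<in> C1_circle"
    and simple: "\<And>x. f (circle_of x) = 0 \<Longrightarrow> deriv (f \<circ> circle_of) x \<noteq> 0"
  obtains m where "m > 0" "\<And>x. \<bar>f (circle_of x)\<bar> \<le> m \<Longrightarrow> \<bar>deriv (f \<circ> circle_of) x\<bar> \<ge> m"
proof -
  let ?F = "f \<circ> circle_of" and ?F' = "deriv (f \<circ> circle_of)"
  let ?n = "\<lambda>x. \<bar>?F x\<bar> + \<bar>?F' x\<bar>"
  have "continuous_on UNIV ?F"
    using DERIV_isCont[OF C1_circle_has_deriv(1)[OF f]]
    by (intro continuous_at_imp_continuous_on ballI)
  then have "continuous_on UNIV ?n"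
    by (intro continuous_on_add continuous_on_rabs C1_circle_has_deriv(2)[OF f])
  then have "continuous_on {0..1} ?n" by (rule continuous_on_subset) simp
  then have "\<exists>x\<in>{0..1}. \<forall>y\<in>{0..1}. ?n x \<le> ?n y"
    by (intro continuous_attains_inf) auto
  then obtain x0 where x0: "\<And>x. x \<in> {0..1} \<Longrightarrow> ?n x0 \<le> ?n x" by blast
  have le: "?n x0 \<le> ?n x" for x
  proof -
    have c: "circle_of (frac x) = circle_of x" by (simp add: circle_of_eq_iff frac_def)
    have "?n (frac x) = ?n x" using deriv_periodic[OF f c] c by simp
    moreover have "frac x \<in> {0..1}" using frac_lt_1[of x] by (simp add: less_imp_le)
    ultimately show ?thesis using x0 by metis
  qed
  have "?n x0 > 0" using simple[of x0] by (cases "?F x0 = 0") auto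
  then show ?thesis
  proof (intro that[of "?n x0 / 2"])
    fix x assume "\<bar>f (circle_of x)\<bar> \<le> ?n x0 / 2"
    then show "\<bar>?F' x\<bar> \<ge> ?n x0 / 2" using le[of x] by simp
  qed simp
qed

lemma sgn_perturb: "\<bar>r\<bar> < \<bar>p\<bar> \<Longrightarrow> sgn (p + r) = sgn (p :: real)"
  by (auto simp: sgn_if abs_if split: if_splits)

text \<open>Closeness of derivatives enters the later estimates only as the Lipschitz constant
  \<open>\<epsilon>\<close> of the difference, by the mean value inequality.\<close>

lemma C1_ball_bounds:
  assumes f: "f \<in> C1_circle" and g: "g \<in> C1_ball f \<epsilon>"
  shows "\<bar>g p - f p\<bar> < \<epsilon>"
    and "\<bar>(g (circle_of u) - f (circle_of u)) - (g (circle_of v) - f (circle_of v))\<bar> \<le> \<epsilon> * \<bar>u - v\<bar>"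
proof -
  let ?d = "\<lambda>p. g p - f p"
  have d: "?d \<in> C1_circle" and norm: "C1_norm ?d < \<epsilon>"
    using f g C1_circle_diff by (auto simp: C1_ball_def)
  note bounds = C1_norm_bounds[OF d]
  show "\<bar>g p - f p\<bar> < \<epsilon>"
    using bounds(1)[of p] bounds(4) norm unfolding C1_norm_def by linarith
  have "norm ((?d \<circ> circle_of) u - (?d \<circ> circle_of) v) \<le> \<epsilon> * norm (u - v)"
  proof (rule field_differentiable_bound[of UNIV])
    show "((?d \<circ> circle_of) has_real_derivative deriv (?d \<circ> circle_of) z) (at z within UNIV)" for z
      using C1_circle_has_deriv(1)[OF d] by simp
    show "norm (deriv (?d \<circ> circle_of) z) \<le> \<epsilon>" for z
      using bounds(3)[of z] bounds(2) norm unfolding C1_norm_def real_norm_def by linarith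
  qed auto
  then show "\<bar>?d (circle_of u) - ?d (circle_of v)\<bar> \<le> \<epsilon> * \<bar>u - v\<bar>" by simp
qed

lemma simple_zeros_imp_structurally_stable:
  assumes f: "f \<in> C1_circle"
    and simple: "\<And>x. f (circle_of x) = 0 \<Longrightarrow> deriv (f \<circ> circle_of) x \<noteq> 0"
  shows "structurally_stable f"
proof -
  define F F' where "F = f \<circ> circle_of" and "F' = deriv (f \<circ> circle_of)"
  have der: "(F has_real_derivative F' x) (at x)" for x
    using C1_circle_has_deriv(1)[OF f] by (simp add: F_def F'_def)
  have contF: "continuous_on UNIV F"
    using DERIV_isCont[OF der] by (simp add: continuous_at_imp_continuous_on)
  have contF': "continuous_on UNIV F'"
    using C1_circle_has_deriv(2)[OF f] by (simp add: F'_def)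
  obtain m where "m > 0" and m: "\<And>x. \<bar>F x\<bar> \<le> m \<Longrightarrow> \<bar>F' x\<bar> \<ge> m"
    using simple_zeros_gap[OF f simple] by (auto simp: F_def F'_def)
  define K where "K = {x. \<bar>F x\<bar> \<ge> m}"
  \<comment> \<open>A piecewise linear cutoff: 1 for \<open>\<bar>v\<bar> \<le> m / 2\<close>, 0 for
    \<open>\<bar>v\<bar> \<ge> m\<close>, with slope at most \<open>2 / m\<close>.\<close>
  define \<psi> where "\<psi> = (\<lambda>v. max 0 (min 1 (2 - 2 * \<bar>v\<bar> / m)))"
  have \<psi>01: "0 \<le> \<psi> v" "\<psi> v \<le> 1" for v by (auto simp: \<psi>_def)
  have \<psi>_lip: "\<bar>\<psi> u - \<psi> v\<bar> \<le> 2 / m * \<bar>u - v\<bar>" for u v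
  proof -
    have "\<bar>\<psi> u - \<psi> v\<bar> \<le> \<bar>2 * \<bar>u\<bar> / m - 2 * \<bar>v\<bar> / m\<bar>"
      unfolding \<psi>_def by linarith
    also have "2 * \<bar>u\<bar> / m - 2 * \<bar>v\<bar> / m = 2 / m * (\<bar>u\<bar> - \<bar>v\<bar>)"
      by (simp add: right_diff_distrib)
    also have "\<bar>\<dots>\<bar> = 2 / m * \<bar>\<bar>u\<bar> - \<bar>v\<bar>\<bar>"
      unfolding abs_mult using \<open>m > 0\<close> by simp
    also have "\<dots> \<le> 2 / m * \<bar>u - v\<bar>"
      using \<open>m > 0\<close> by (intro mult_left_mono) auto
    finally show ?thesis .
  qed
  have per: "circle_of (x + 1) = circle_of x" for x by (simp add: circle_of_eq_iff)
  \<comment> \<open>Periodicity and Rolle's theorem give a critical point of \<open>F\<close>. It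
    lies in \<open>K\<close>, as slopes are at least \<open>m\<close> in absolute value off
    \<open>K\<close>, and its integer translates make \<open>K\<close> unbounded in both
    directions.\<close>
  obtain c where c: "\<And>n. n \<in> \<int> \<Longrightarrow> c + n \<in> K"
  proof -
    have "\<exists>z. 0 < z \<and> z < 1 \<and> (F has_real_derivative 0) (at z)"
    proof (rule Rolle)
      show "F 0 = F 1" using per[of 0] by (simp add: F_def)
      show "continuous_on {0..1} F" using contF continuous_on_subset by blast
      show "F differentiable at x" for x using der by (auto simp: real_differentiable_def)
    qed simp
    then obtain z where "(F has_real_derivative 0) (at z)" by blast
    then have "F' z = 0" using der DERIV_unique by blast
    then have "z \<in> K" using m[of z] \<open>m > 0\<close> by (force simp: K_def)
    moreover have "F (z + n) = F z" if "n \<in> \<int>" for n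
    proof -
      have "circle_of (z + n) = circle_of z" using that by (simp add: circle_of_eq_iff)
      then show ?thesis by (simp add: F_def)
    qed
    ultimately show ?thesis by (intro that[of z]) (auto simp: K_def)
  qed
  \<comment> \<open>With radius \<open>m / 4\<close> an increment of the blend differs from that of
    \<open>F\<close> by at most the fraction \<open>1/4\<close> (from the slope of \<open>D\<close>)
    plus \<open>1/2\<close> (from the slope \<open>2 / m\<close> of the cutoff times the size of
    \<open>D\<close>), which is less than 1. Also \<open>\<bar>D\<bar>\<close> stays below
    \<open>m / 2\<close>.\<close>
  have "topologically_equivalent f g" if g: "g \<in> C1_ball f (m / 4)" for g
  proof -
    have gC: "g \<in> C1_circle" using g by (simp add: C1_ball_def)
    define D where "D = (\<lambda>x. g (circle_of x) - f (circle_of x))"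
    have D: "\<bar>D x\<bar> < m / 4" and D_lip: "\<bar>D u - D v\<bar> \<le> m / 4 * \<bar>u - v\<bar>" for x u v
      using C1_ball_bounds[OF f g] by (auto simp: D_def)
    define B where "B = (\<lambda>x. F x + \<psi> (F x) * D x)"
    interpret gapwise_comonotone F B K
    proof
      show "continuous_on UNIV F" by (rule contF)
      show "closed K"
        unfolding K_def by (intro closed_Collect_le continuous_intros contF)
      have "continuous_on UNIV D"
        by (rule continuous_on_lipschitz_real[OF D_lip])
      then show "continuous_on UNIV B"
        unfolding B_def \<psi>_def using \<open>m > 0\<close> by (intro continuous_intros contF) auto
      show "\<exists>a\<in>K. a \<le> x" for x
        using c[of "of_int (\<lfloor>x - c\<rfloor>)"] by (intro bexI[of _ "c + of_int \<lfloor>x - c\<rfloor>"]) (simp_all, linarith)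
      show "\<exists>b\<in>K. x \<le> b" for x
        using c[of "of_int (\<lceil>x - c\<rceil>)"] by (intro bexI[of _ "c + of_int \<lceil>x - c\<rceil>"]) (simp_all, linarith)
      show "F x = B x" if "x \<in> K" for x
        using that \<open>m > 0\<close> by (auto simp: K_def B_def \<psi>_def field_simps)
      show "F (x + 1) = F x" "B (x + 1) = B x" "x + 1 \<in> K \<longleftrightarrow> x \<in> K" for x
        by (auto simp: F_def B_def D_def K_def per)
      fix a b :: real assume gap: "{a<..<b} \<inter> K = {}"
      show "\<exists>\<sigma>. \<forall>x y. a \<le> x \<and> x < y \<and> y \<le> b \<longrightarrow> \<sigma> * (F y - F x) > 0 \<and> \<sigma> * (B y - B x) > 0"
      proof (cases "a < b")
        case False
        then show ?thesis by auto
      next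
        case True
        \<comment> \<open>\<open>F'\<close> has no zero inside the gap, hence constant sign there;
          its value at the midpoint serves as the orientation \<open>\<sigma>\<close>.\<close>
        define mid where "mid = (a + b) / 2"
        have large: "\<bar>F' z\<bar> \<ge> m" if "a < z" "z < b" for z
          using gap that m[of z] by (force simp: K_def)
        have sgn: "F' mid * F' z > 0" if z: "a < z" "z < b" for z
        proof (rule ccontr)
          assume "\<not> F' mid * F' z > 0"
          then have "0 \<in> closed_segment (F' mid) (F' z)"
            by (auto simp: closed_segment_eq_real_ivl zero_less_mult_iff)
          then obtain w where w: "w \<in> closed_segment mid z" "F' w = 0"
            using IVT'_closed_segment_real[of 0 F' mid z] continuous_on_subset[OF contF'] by blast
          then have "a < w" "w < b"
            using z True by (auto simp: closed_segment_eq_real_ivl mid_def split: if_splits)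
          then show False using large[of w] w(2) \<open>m > 0\<close> by simp
        qed
        have "F' mid * (F y - F x) > 0 \<and> F' mid * (B y - B x) > 0" if xy: "a \<le> x" "x < y" "y \<le> b" for x y
        proof
          \<comment> \<open>The intermediate point is interior to the gap, where
            \<open>large\<close> and \<open>sgn\<close> apply, even if \<open>x\<close> and
            \<open>y\<close> are its end points.\<close>
          obtain z where z: "x < z" "z < y" "F y - F x = (y - x) * F' z"
            using MVT2[OF xy(2) der] by blast
          have zab: "a < z" "z < b" using z xy by auto
          show pos: "F' mid * (F y - F x) > 0"
            using mult_pos_pos[OF _ sgn[OF zab], of "y - x"] xy(2) by (simp add: z(3) mult.left_commute)
          have "m * (y - x) \<le> \<bar>F y - F x\<bar>"
            using large[OF zab] xy(2) by (simp add: z(3) abs_mult mult.commute)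
          have "(B y - B x) - (F y - F x) = \<psi> (F y) * (D y - D x) + (\<psi> (F y) - \<psi> (F x)) * D x"
            by (simp add: B_def algebra_simps)
          also have "\<bar>\<dots>\<bar> \<le> \<bar>\<psi> (F y)\<bar> * \<bar>D y - D x\<bar> + \<bar>\<psi> (F y) - \<psi> (F x)\<bar> * \<bar>D x\<bar>"
            by (metis abs_mult abs_triangle_ineq)
          also have "\<dots> \<le> 1 * (m / 4 * \<bar>y - x\<bar>) + 2 / m * \<bar>F y - F x\<bar> * (m / 4)"
            using \<psi>01 D_lip[of y x] \<psi>_lip D[of x] \<open>m > 0\<close>
            by (intro add_mono mult_mono) (auto simp: less_imp_le)
          also have "\<dots> = m * (y - x) / 4 + \<bar>F y - F x\<bar> / 2"
            using \<open>m > 0\<close> xy(2) by simp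
          also have "\<dots> \<le> 3 / 4 * \<bar>F y - F x\<bar>"
            using \<open>m * (y - x) \<le> \<bar>F y - F x\<bar>\<close> by simp
          also have "\<dots> < \<bar>F y - F x\<bar>" using pos by auto
          finally have "sgn (B y - B x) = sgn (F y - F x)"
            using sgn_perturb[of "(B y - B x) - (F y - F x)" "F y - F x"] by simp
          then have "sgn (F' mid * (B y - B x)) = sgn (F' mid * (F y - F x))"
            by (simp add: sgn_mult)
          then show "F' mid * (B y - B x) > 0" using pos by (metis sgn_1_pos)
        qed
        then show ?thesis by blast
      qed
    qed
    show ?thesis
    proof (rule topologically_equivalent_by_lift[OF f gC strict_mono_conj_map surj_conj_map])
      show "conj_map (x + 1) = conj_map x + 1" for x by (rule conj_map_translate)
      \<comment> \<open>Where \<open>\<bar>F y\<bar> \<le> m / 2\<close> the cutoff is 1 and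
        \<open>B\<close> coincides with the lift of \<open>g\<close>; elsewhere \<open>D\<close> is
        too small to change the sign of \<open>F\<close>, with or without the cutoff.\<close>
      have "sgn (g (circle_of y)) = sgn (B y)" for y
      proof (cases "\<bar>F y\<bar> \<le> m / 2")
        case True
        then have "\<psi> (F y) = 1" using \<open>m > 0\<close> by (simp add: \<psi>_def field_simps)
        then show ?thesis by (simp add: B_def F_def D_def)
      next
        case False
        have "\<bar>\<psi> (F y) * D y\<bar> \<le> 1 * \<bar>D y\<bar>"
          unfolding abs_mult using \<psi>01 by (intro mult_right_mono) auto
        then have "sgn (B y) = sgn (F y)"
          unfolding B_def using False D[of y] by (intro sgn_perturb) auto
        moreover have "sgn (F y + D y) = sgn (F y)"
          using False D[of y] by (intro sgn_perturb) auto
        ultimately show ?thesis by (simp add: F_def D_def)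
      qed
      then show "sgn (g (circle_of (conj_map x))) = sgn (f (circle_of x))" for x
        using conj_map(2)[of x] by (simp add: F_def)
    qed
  qed
  then show ?thesis
    unfolding structurally_stable_iff using \<open>m > 0\<close> by (intro exI[of _ "m / 4"]) auto
qed

section \<open>Density of the stable fields by Sard's theorem\<close>

lemma exists_regular_value:
  fixes F :: "real \<Rightarrow> real"
  assumes der: "\<And>x. (F has_real_derivative F' x) (at x)" and "a < b"
  shows "\<exists>c\<in>{a<..<b}. \<forall>x. F x = c \<longrightarrow> F' x \<noteq> 0"
proof (rule ccontr)
  assume contra: "\<not> ?thesis"
  \<comment> \<open>\<open>F\<close> is viewed as a map of one-dimensional vectors, the setting of
    \<open>baby_Sard\<close>; at critical points the derivative matrix has rank 0. Without a regular
    value in the interval, the negligible set of critical values would contain a nonempty open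
    box.\<close>
  let ?S = "{v :: real^1. F' (v $ 1) = 0}"
  let ?f = "\<lambda>v :: real^1. vec (F (v $ 1)) :: real^1"
  have "negligible (?f ` ?S)"
  proof (rule baby_Sard)
    fix v :: "real^1" assume "v \<in> ?S"
    then have "(F has_derivative (\<lambda>h. 0)) (at (v $ 1))"
      using der[of "v $ 1"] by (simp add: has_field_derivative_def lambda_zero)
    moreover have "((\<lambda>w :: real^1. w $ 1) has_derivative (\<lambda>h. h $ 1)) (at v)"
      by (intro bounded_linear_imp_has_derivative bounded_linear_vec_nth)
    ultimately have "((\<lambda>w :: real^1. F (w $ 1)) has_derivative (\<lambda>h. 0)) (at v)"
      using has_derivative_compose[of "\<lambda>w :: real^1. w $ 1" _ v UNIV F "\<lambda>h. 0"] by simp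
    then have "(?f has_derivative (\<lambda>h. vec 0)) (at v)"
      by (rule bounded_linear.has_derivative[rotated])
        (auto intro!: linear_conv_bounded_linear[THEN iffD1] linearI simp: vec_eq_iff)
    then show "(?f has_derivative (\<lambda>h. 0)) (at v within ?S)"
      by (simp add: has_derivative_at_withinI)
    have "matrix (\<lambda>h :: real^1. 0 :: real^1) = 0"
      by (simp add: matrix_def vec_eq_iff)
    then show "rank (matrix (\<lambda>h :: real^1. 0 :: real^1)) < CARD(1)"
      by simp
  qed simp
  moreover have "box (vec a) (vec b) \<subseteq> ?f ` ?S"
  proof
    fix w :: "real^1" assume "w \<in> box (vec a) (vec b)"
    then have "w $ 1 \<in> {a<..<b}" by (simp add: mem_box_cart)
    then obtain x where "F x = w $ 1" "F' x = 0" using contra by blast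
    then show "w \<in> ?f ` ?S"
      by (intro image_eqI[of _ _ "vec x"]) (auto simp: vec_eq_iff)
  qed
  ultimately have "negligible (box (vec a) (vec b :: real^1))"
    using negligible_subset by blast
  moreover have "vec ((a + b) / 2) \<in> box (vec a) (vec b :: real^1)"
    using \<open>a < b\<close> by (simp add: mem_box_cart)
  ultimately show False
    using open_not_negligible[OF open_box] by blast
qed

text \<open>Subtracting a regular value \<open>c\<close> of the lift leaves the derivative unchanged
  and turns the points with value \<open>c\<close> into the zeros, which are therefore simple. The
  distance moved in the \<open>C1_norm\<close> is exactly \<open>c\<close>.\<close>

lemma SS1_dense:
  assumes f: "f \<in> C1_circle" and "\<epsilon> > 0"
  shows "\<exists>g\<in>SS1. g \<in> C1_ball f \<epsilon>"
proof -
  obtain c where c: "0 < c" "c < \<epsilon>"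
    "\<And>x. f (circle_of x) = c \<Longrightarrow> deriv (f \<circ> circle_of) x \<noteq> 0"
    using exists_regular_value[OF C1_circle_has_deriv(1)[OF f] \<open>\<epsilon> > 0\<close>] by auto
  define k :: "circle \<Rightarrow> real" where "k = (\<lambda>_. c)"
  have k: "k \<in> C1_circle" by (simp add: C1_circle_def k_def o_def)
  define g where "g = (\<lambda>p. f p - k p)"
  have g: "g \<in> C1_circle" unfolding g_def by (rule C1_circle_diff[OF f k])
  have "deriv (g \<circ> circle_of) x = deriv (f \<circ> circle_of) x" for x
    unfolding g_def deriv_diff_circle[OF f k] by (simp add: k_def o_def)
  then have "structurally_stable g"
    using c(3) by (intro simple_zeros_imp_structurally_stable[OF g]) (simp add: g_def k_def)
  moreover have "C1_norm (\<lambda>p. g p - f p) = c"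
    using c(1) by (simp add: C1_norm_def g_def k_def o_def)
  ultimately show ?thesis using g c(2) by (auto simp: SS1_def C1_ball_def)
qed

theorem theorem2:
  shows "openin C1_topology SS1 \<and> C1_topology closure_of SS1 = C1_circle"
proof
  show "openin C1_topology SS1" by (rule openin_SS1)
  show "C1_topology closure_of SS1 = C1_circle"
  proof
    show "C1_topology closure_of SS1 \<subseteq> C1_circle"
      by (metis closure_of_subset_topspace topspace_C1_topology)
    show "C1_circle \<subseteq> C1_topology closure_of SS1"
    proof
      fix f assume f: "f \<in> C1_circle"
      have "\<exists>g\<in>SS1. g \<in> U" if "f \<in> U" "openin C1_topology U" for U
        using that SS1_dense[OF f] unfolding openin_C1_topology by blast
      then show "f \<in> C1_topology closure_of SS1"
        using f by (auto simp: in_closure_of topspace_C1_topology)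
    qed
  qed
qed

end
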